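(* Fix $a>0$. Then the inequality $$\frac{\pi\sqrt{a}}{\arctan(\pi\sqrt{a})}\le\int_{-\infty}^{\infty}\left(|g(x)|^2+a\,|g'(x)|^2\right)dx$$ holds for every $g\in PW^2$ with $g(0)=1$, and the unique extremal function (among $g\in PW^2$ with $g(0)=1$) for which it reduces to an equality is $$g(z)=\frac{\pi\sqrt{a}}{\arctan(\pi\sqrt{a})}\int_0^1\frac{\cos(\pi z t)}{1+a\pi^2t^2}\,dt.$$
   Context: $PW^2$ is the Paley--Wiener space of entire functions $g:\mathbb{C}\to\mathbb{C}$ of exponential type at most $\pi$ whose restriction to $\mathbb{R}$ belongs to $L^2(\mathbb{R})$. An entire function $G$ has exponential type at most $\tau>0$ if for every $\varepsilon>0$ there is $C_\varepsilon>0$ with $|G(z)|\le C_\varepsilon e^{(\tau+\varepsilon)|z|}$ for all $z\in\mathbb{C}$. *)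

theory Defs
  imports "HOL-Analysis.Analysis"
begin

definition exponential_type_le :: "real \<Rightarrow> (complex \<Rightarrow> complex) \<Rightarrow> bool" where
  "exponential_type_le \<tau> G \<longleftrightarrow>
     (\<forall>\<epsilon>>0. \<exists>C>0. \<forall>z. cmod (G z) \<le> C * exp ((\<tau> + \<epsilon>) * cmod z))"

definition PW2 :: "(complex \<Rightarrow> complex) set" where
  "PW2 = {g. g holomorphic_on UNIV \<and> exponential_type_le pi g \<and>
             integrable lborel (\<lambda>x::real. (cmod (g (of_real x)))\<^sup>2)}"

(* The Bochner integral is 0 on non-integrable functions. For g in PW2 the integrand is
   integrable (g' is again in PW2), so this convention is never used there. *)
definition sobolev_energy :: "real \<Rightarrow> (complex \<Rightarrow> complex) \<Rightarrow> real" where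
  "sobolev_energy a g =
     (LINT x|lborel. (cmod (g (of_real x)))\<^sup>2 + a * (cmod (deriv g (of_real x)))\<^sup>2)"

end

(* Let k(z) = \<integral> cos(pi z t) / (1 + a pi^2 t^2) dt over [0,1]. On the real line k - a k'' = sin(pi x)/(pi x),
   so integration by parts and the reproducing property of the sinc kernel give
   \<integral> g k + a g' k' = g(0) for every g in PW^2: k represents evaluation at 0 in the Sobolev inner
   product. With c = 1/k(0) and g(0) = 1 the energy of g therefore equals c plus the energy of g - c k.

   The reproducing property, and the fact that g' is square integrable, are obtained without the
   Paley-Wiener theorem. Phragmen-Lindeloef, applied to (G(z) - G(0))/z for a primitive G of g, gives
   |g(z)| <= C (1 + |z|) exp(tau |Im z|) for every tau > pi. If W is entire and
   |W(z)| <= M exp(tau |Im z|), closing the contour in the two half planes evaluates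
   \<integral> (W(x) sin(tau x) - tau W(0) x) / x^2 dx = pi W'(0), and products W of g with
   sinc factors yield integral formulas for g(0) and g'(0). *)
theory Submission
  imports Defs "HOL-Complex_Analysis.Complex_Analysis" "HOL-Real_Asymp.Real_Asymp"
begin

subsection \<open>Growth of functions of exponential type\<close>

text \<open>The density 1 / (1 + a pi^2 t^2) comes from the Fourier side. If g(x) is the integral of
  u(t) exp(i pi x t) over [-1,1], the energy is a multiple of the integral of (1 + a pi^2 t^2)
  |u(t)|^2, and g(0) is the integral of u. Equality in Cauchy-Schwarz makes u proportional to that
  density, whose integral over [0,1] is arctan(pi sqrt a) / (pi sqrt a). The proof never represents
  a general g this way.

  The obstacle is pointwise control. Square integrability bounds only averages of g, hence the
  primitive; and the factor 1 + |z| left at the end is too large for the contour estimates. A sinc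
  factor absorbs it, but raises the type. For g(0) the type must come back to exactly pi, because
  the equation for k has sin(pi x) on its right side; this costs a limit. The formula for g' only
  feeds an estimate, so fixed types above pi do, without a limit. Boundedness of g on the real line,
  needed for the boundary terms, follows from the reproducing formula for translates.\<close>

lemma entire_compose:
  "f holomorphic_on UNIV \<Longrightarrow> g holomorphic_on S \<Longrightarrow> (\<lambda>w. f (g w)) holomorphic_on S"
  using holomorphic_on_compose_gen[of g S f UNIV] by (simp add: o_def)

text \<open>The hypotheses place \<open>s^2\<close> in the sector of half-angle pi/4, hence
  \<open>s\<close> in that of half-angle pi/8 and \<open>s^3\<close> in that of half-angle 3 pi/8 <
  pi/2. The sharp constant would be cos(3 pi/8); 1/16 is what the crude estimate |Im s| \<le> Re s /
  2 yields.\<close>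

lemma Re_cube_ge:
  assumes "0 \<le> Re s" "\<bar>Im (s\<^sup>2)\<bar> \<le> Re (s\<^sup>2)"
  shows "Re (s ^ 3) \<ge> cmod s ^ 3 / 16"
proof -
  define p where "p = Re s"
  define q where "q = Im s"
  have s2: "Re (s\<^sup>2) = p\<^sup>2 - q\<^sup>2" "Im (s\<^sup>2) = 2 * p * q"
    by (simp_all add: p_def q_def power2_eq_square)
  have p0: "p \<ge> 0" using assms(1) by (simp add: p_def)
  have h: "2 * p * \<bar>q\<bar> \<le> p\<^sup>2 - q\<^sup>2"
    using assms(2) p0 unfolding s2 by (simp add: abs_mult)
  have q2: "\<bar>q\<bar> \<le> p / 2"
  proof (rule ccontr)
    assume "\<not> ?thesis"
    then have q: "\<bar>q\<bar> > p / 2" by simp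
    then have "2 * p * \<bar>q\<bar> \<ge> 2 * p * (p / 2)" using p0 by (intro mult_left_mono) auto
    moreover have "q\<^sup>2 > 0" using q p0 by auto
    ultimately show False using h by (simp add: power2_eq_square)
  qed
  have "\<bar>q\<bar>\<^sup>2 \<le> (p / 2)\<^sup>2" using q2 by (intro power_mono) auto
  then have q4: "q\<^sup>2 \<le> p\<^sup>2 / 4" by (simp add: power_divide)
  have cm: "(cmod s)\<^sup>2 = p\<^sup>2 + q\<^sup>2" by (simp add: cmod_power2 p_def q_def)
  have "(p\<^sup>2 + q\<^sup>2) \<le> (2 * p)\<^sup>2" 
  proof -
    have "(2 * p)\<^sup>2 = 4 * p\<^sup>2" by (simp add: power_mult_distrib)
    then show ?thesis using q4 zero_le_power2[of p] by linarith
  qed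
  then have pc: "cmod s / 2 \<le> p"
    using cm p0 by (metis abs_of_nonneg divide_le_eq_numeral1(1) mult.commute mult_nonneg_nonneg
        norm_ge_zero power2_le_imp_le zero_le_numeral)
  have re: "Re (s ^ 3) = p * (p\<^sup>2 - 3 * q\<^sup>2)"
    by (simp add: p_def q_def power3_eq_cube power2_eq_square algebra_simps)
  have "(cmod s / 2) * ((cmod s)\<^sup>2 / 8) \<le> p * (p\<^sup>2 - 3 * q\<^sup>2)"
    using pc cm q4 p0 zero_le_power2[of p] zero_le_power2[of q] by (intro mult_mono) linarith+
  then show ?thesis unfolding re by (simp add: power2_eq_square power3_eq_cube)
qed

lemma phragmen_lindelof_quadrant:
  fixes F :: "complex \<Rightarrow> complex"
  assumes hol: "F holomorphic_on UNIV"
    and growth: "\<And>z. cmod (F z) \<le> C * exp (c * cmod z)"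
    and re: "\<And>x. x \<ge> 0 \<Longrightarrow> cmod (F (of_real x)) \<le> K"
    and im: "\<And>y. y \<ge> 0 \<Longrightarrow> cmod (F (\<i> * of_real y)) \<le> K"
    and "K > 0" "0 \<le> Re z" "0 \<le> Im z"
  shows "cmod (F z) \<le> K"
proof -
  \<comment> \<open>Multiplication by \<open>1 - \<i>\<close> turns the quadrant into the sector \<open>\<bar>arg\<bar> \<le> \<pi>/4\<close>, where the cube of the
    square root, of order \<open>3/2 > 1\<close>, has positive real part and so beats the growth of \<open>F\<close>.\<close>
  define s where "s = (\<lambda>z. csqrt ((1 - \<i>) * z + 1))"
  have w: "Re ((1 - \<i>) * z + 1) = Re z + Im z + 1" "Im ((1 - \<i>) * z + 1) = Im z - Re z" for z
    by (auto simp: algebra_simps)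
  have s3: "Re (s z ^ 3) \<ge> cmod z * sqrt (cmod z) / 16" if "0 \<le> Re z" "0 \<le> Im z" for z
  proof -
    have sq: "(s z)\<^sup>2 = (1 - \<i>) * z + 1" by (simp add: s_def)
    have "\<bar>Im ((s z)\<^sup>2)\<bar> \<le> Re ((s z)\<^sup>2)" unfolding sq w using that by auto
    moreover have "0 \<le> Re (s z)" unfolding s_def using csqrt_principal[of "(1 - \<i>) * z + 1"] by auto
    ultimately have 1: "Re (s z ^ 3) \<ge> cmod (s z) ^ 3 / 16" by (rule Re_cube_ge[rotated])
    have "cmod z \<le> \<bar>Re z\<bar> + \<bar>Im z\<bar>" by (rule cmod_le)
    also have "\<dots> \<le> Re ((1 - \<i>) * z + 1)" unfolding w using that by auto
    also have "\<dots> \<le> cmod ((s z)\<^sup>2)" unfolding sq by (rule complex_Re_le_cmod)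
    finally have 2: "cmod z \<le> (cmod (s z))\<^sup>2" by (simp add: norm_power)
    then have 3: "sqrt (cmod z) \<le> cmod (s z)" by (simp add: real_le_lsqrt)
    have "cmod z * sqrt (cmod z) \<le> (cmod (s z))\<^sup>2 * cmod (s z)"
      by (intro mult_mono 2 3) auto
    with 1 show ?thesis by (simp add: power2_eq_square power3_eq_cube)
  qed
  have main: "cmod (F z) * exp (- \<eta> * Re (s z ^ 3)) \<le> K" if \<eta>: "\<eta> > 0" for \<eta>
  proof -
    \<comment> \<open>The power 3/2 of \<open>r\<close> wins against the linear growth exponent for
      every \<open>\<eta> > 0\<close>, so on a large enough arc the damped function is already below
      \<open>K\<close>.\<close>
    have "((\<lambda>r. C * exp (c * r - \<eta> * (r * sqrt r / 16))) \<longlongrightarrow> 0) at_top"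
      using \<eta> by real_asymp
    then have "\<forall>\<^sub>F r in at_top. C * exp (c * r - \<eta> * (r * sqrt r / 16)) < K"
      using \<open>K > 0\<close> by (simp add: order_tendstoD)
    then have "\<forall>\<^sub>F r in at_top. C * exp (c * r - \<eta> * (r * sqrt r / 16)) < K \<and> r > cmod z"
      using eventually_gt_at_top eventually_conj by blast
    then obtain R where R: "C * exp (c * R - \<eta> * (R * sqrt R / 16)) < K" "R > cmod z"
      using eventually_happens'[OF trivial_limit_at_top_linorder] by blast
    define S where "S = cball 0 R \<inter> {z. 0 \<le> Re z} \<inter> {z. 0 \<le> Im z}"
    define H where "H = (\<lambda>z. F z * exp (- of_real \<eta> * s z ^ 3))"
    have normH: "cmod (H z) = cmod (F z) * exp (- \<eta> * Re (s z ^ 3))" for z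
      by (simp add: H_def norm_mult)
    have clS: "closed S" unfolding S_def
      by (intro closed_Int closed_cball closed_halfspace_Re_ge closed_halfspace_Im_ge)
    have openT: "open (ball 0 R \<inter> {z. 0 < Re z} \<inter> {z. 0 < Im z})"
      by (intro open_Int open_ball open_halfspace_Re_gt open_halfspace_Im_gt)
    have holH: "H holomorphic_on S"
    proof -
      \<comment> \<open>The summand 1 in \<open>s\<close> serves here: it keeps the radicand off the
        branch cut even at the corner \<open>z = 0\<close>, so that \<open>H\<close> is holomorphic
        on all of \<open>S\<close>.\<close>
      have "(1 - \<i>) * z + 1 \<notin> \<real>\<^sub>\<le>\<^sub>0" if "z \<in> S" for z
        using that w(1)[of z] by (auto simp: S_def complex_nonpos_Reals_iff)
      then show ?thesis unfolding H_def s_def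
        by (intro holomorphic_intros holomorphic_on_subset[OF hol]) auto
    qed
    have "cmod (H z) \<le> K"
    proof (rule maximum_modulus_frontier[of H S])
      show "H holomorphic_on interior S" using holH holomorphic_on_subset interior_subset by blast
      show "continuous_on (closure S) H"
        using clS holH holomorphic_on_imp_continuous_on by simp
      show "bounded S" unfolding S_def by (meson bounded_Int bounded_cball)
      show "z \<in> S" using R assms by (auto simp: S_def)
      fix u assume u: "u \<in> frontier S"
      have uS: "u \<in> S" using u clS frontier_subset_closed by blast
      have "u \<notin> interior S" using u by (simp add: frontier_def)
      moreover have "ball 0 R \<inter> {z. 0 < Re z} \<inter> {z. 0 < Im z} \<subseteq> interior S"
        using openT by (intro interior_maximal) (auto simp: S_def)
      ultimately have "\<not> (cmod u < R \<and> 0 < Re u \<and> 0 < Im u)" by auto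
      with uS consider "Re u = 0" "Im u \<ge> 0" | "Im u = 0" "Re u \<ge> 0" | "cmod u = R"
        by (force simp: S_def)
      moreover have nn: "0 \<le> Re u" "0 \<le> Im u" using uS by (auto simp: S_def)
      have "0 \<le> cmod u * sqrt (cmod u) / 16" by simp
      with s3[OF nn] have s0: "0 \<le> Re (s u ^ 3)" by linarith
      have e1: "exp (- \<eta> * Re (s u ^ 3)) \<le> 1" using s0 \<eta> by simp
      have HF: "cmod (H u) \<le> cmod (F u)"
        unfolding normH using mult_left_mono[OF e1, of "cmod (F u)"] by simp
      ultimately show "cmod (H u) \<le> K"
      proof cases
        case 1
        then have "u = \<i> * of_real (Im u)" by (simp add: complex_eq_iff)
        with im[of "Im u"] 1 HF show ?thesis by (metis order_trans)
      next
        case 2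
        then have "u = of_real (Re u)" by (simp add: complex_eq_iff)
        with re[of "Re u"] 2 HF show ?thesis by (metis order_trans)
      next
        case 3
        have "\<eta> * (R * sqrt R / 16) \<le> \<eta> * Re (s u ^ 3)"
          using s3[OF nn] 3 \<eta> by (intro mult_left_mono) auto
        then have e: "exp (- \<eta> * Re (s u ^ 3)) \<le> exp (- (\<eta> * (R * sqrt R / 16)))" by simp
        have "cmod (H u) \<le> (C * exp (c * R)) * exp (- (\<eta> * (R * sqrt R / 16)))"
          unfolding normH using growth[of u] order_trans[OF norm_ge_zero growth[of u]] 3
          by (intro mult_mono e) simp_all
        also have "\<dots> = C * exp (c * R - \<eta> * (R * sqrt R / 16))"
          by (simp only: mult.assoc mult_exp_exp add_uminus_conv_diff)
        finally show ?thesis using R by simp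
      qed
    qed
    then show ?thesis by (simp add: normH)
  qed
  \<comment> \<open>For fixed \<open>z\<close> the damping factor tends to 1 as
    \<open>\<eta>\<close> decreases to 0, while the bound \<open>K\<close> does not depend on
    \<open>\<eta>\<close>.\<close>
  have "((\<lambda>\<eta>. cmod (F z) * exp (- \<eta> * Re (s z ^ 3))) \<longlongrightarrow> cmod (F z) * exp (- 0 * Re (s z ^ 3))) (at_right 0)"
    by (intro tendsto_intros)
  moreover have "\<forall>\<^sub>F \<eta> in at_right 0. cmod (F z) * exp (- \<eta> * Re (s z ^ 3)) \<le> K"
    by (rule eventually_mono[OF eventually_at_right_less]) (rule main)
  ultimately show ?thesis using tendsto_upperbound by force
qed

text \<open>The factor exp(i \<open>\<tau>\<close> z) leaves the modulus on the real line unchanged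
  and cancels the growth along the positive imaginary axis. A function of order 1 is borderline for
  a half-plane but harmless in a quadrant, so the upper half-plane is treated as two quadrants; z
  \<mapsto> -z gives the lower one.\<close>

lemma exp_type_bounded_on_reals:
  fixes f :: "complex \<Rightarrow> complex"
  assumes hol: "f holomorphic_on UNIV" and "\<tau> \<ge> 0"
    and growth: "\<And>z. cmod (f z) \<le> C * exp (\<tau> * cmod z)"
    and re: "\<And>x. cmod (f (of_real x)) \<le> K"
  obtains M where "\<And>z. cmod (f z) \<le> M * exp (\<tau> * \<bar>Im z\<bar>)"
proof -
  define M where "M = max K C + 1"
  have "C \<ge> 0" using order_trans[OF norm_ge_zero growth[of 0]] by simp
  then have M: "M > 0" "K \<le> M" "C \<le> M" by (auto simp: M_def)
  have upper: "cmod (h z) \<le> M * exp (\<tau> * Im z)"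
    if h: "h holomorphic_on UNIV" "\<And>z. cmod (h z) \<le> C * exp (\<tau> * cmod z)"
      "\<And>x. cmod (h (of_real x)) \<le> K" and z: "Im z \<ge> 0" for h z
  proof -
    define F where "F = (\<lambda>z. h z * exp (\<i> * of_real \<tau> * z))"
    have nF: "cmod (F z) = cmod (h z) * exp (- \<tau> * Im z)" for z
      by (simp add: F_def norm_mult)
    have hF: "F holomorphic_on UNIV" unfolding F_def by (intro holomorphic_intros h)
    have gF: "cmod (F z) \<le> C * exp (2 * \<tau> * cmod z)" for z
    proof -
      have "- (\<tau> * Im z) \<le> \<tau> * cmod z"
        using mult_left_mono[of "- Im z" "cmod z" \<tau>] abs_Im_le_cmod[of z] \<open>\<tau> \<ge> 0\<close> by simp
      then have "cmod (F z) \<le> (C * exp (\<tau> * cmod z)) * exp (\<tau> * cmod z)"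
        unfolding nF using \<open>C \<ge> 0\<close> by (intro mult_mono h) auto
      also have "\<dots> = C * exp (2 * \<tau> * cmod z)" by (simp add: mult_exp_exp)
      finally show ?thesis .
    qed
    have FR: "cmod (F (of_real x)) \<le> M" for x
      using h(3)[of x] M by (simp add: nF)
    have FI: "cmod (F (\<i> * of_real y)) \<le> M" if "y \<ge> 0" for y
    proof -
      have "cmod (F (\<i> * of_real y)) \<le> (C * exp (\<tau> * y)) * exp (- \<tau> * y)"
        unfolding nF using h(2)[of "\<i> * of_real y"] that \<open>C \<ge> 0\<close>
        by (intro mult_mono) (auto simp: norm_mult)
      also have "\<dots> = C" by (simp add: exp_minus)
      finally show ?thesis using M by simp
    qed
    have "cmod (F z) \<le> M"
    proof (cases "Re z \<ge> 0")
      case True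
      show ?thesis
        by (rule phragmen_lindelof_quadrant[OF hF gF FR FI M(1) True z])
    next
      case False
      \<comment> \<open>The rotation by -\<open>\<i>\<close> carries the second quadrant to the
        first and exchanges the two boundary rays, so the bounds \<open>FR\<close> and
        \<open>FI\<close> swap roles.\<close>
      have "cmod ((\<lambda>w. F (\<i> * w)) (- \<i> * z)) \<le> M"
      proof (rule phragmen_lindelof_quadrant[of "\<lambda>w. F (\<i> * w)" C "2 * \<tau>"])
        show "(\<lambda>w. F (\<i> * w)) holomorphic_on UNIV"
          by (intro entire_compose[OF hF] holomorphic_intros)
        show "cmod (F (\<i> * w)) \<le> C * exp (2 * \<tau> * cmod w)" for w
          using gF[of "\<i> * w"] by (simp add: norm_mult)
        show "cmod (F (\<i> * (\<i> * of_real y))) \<le> M" for y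
          using FR[of "- y"] by (simp flip: mult.assoc)
      qed (use FI M z False in auto)
      then show ?thesis by (simp flip: mult.assoc)
    qed
    then show ?thesis unfolding nF by (simp add: exp_minus field_simps)
  qed
  have "cmod (f z) \<le> M * exp (\<tau> * \<bar>Im z\<bar>)" for z
  proof (cases "Im z \<ge> 0")
    case True
    then show ?thesis using upper[OF hol growth re True] by simp
  next
    case False
    have "cmod ((\<lambda>w. f (- w)) (- z)) \<le> M * exp (\<tau> * Im (- z))"
    proof (rule upper[of "\<lambda>w. f (- w)"])
      show "(\<lambda>w. f (- w)) holomorphic_on UNIV"
        by (intro entire_compose[OF hol] holomorphic_intros)
      show "cmod (f (- w)) \<le> C * exp (\<tau> * cmod w)" for w using growth[of "- w"] by simp
      show "cmod (f (- of_real x)) \<le> K" for x using re[of "- x"] by simp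
    qed (use False in auto)
    then show ?thesis using False by simp
  qed
  then show ?thesis using that by blast
qed


text \<open>On the real line a primitive \<open>G\<close> grows at most linearly, so
  \<open>P\<close> is bounded there and \<open>exp_type_bounded_on_reals\<close> controls it
  everywhere. The factor \<open>1 + cmod z\<close> is the price of returning from \<open>P\<close>
  to \<open>G - G 0 = z P\<close>.\<close>

lemma PW2_growth:
  assumes g: "g \<in> PW2" and "\<tau> > pi"
  obtains C where "\<And>z. cmod (g z) \<le> C * (1 + cmod z) * exp (\<tau> * \<bar>Im z\<bar>)"
proof -
  have hol: "g holomorphic_on UNIV" and ty: "exponential_type_le pi g"
    and L2: "integrable lborel (\<lambda>x::real. (cmod (g (of_real x)))\<^sup>2)"
    using g by (auto simp: PW2_def)
  define N where "N = (LINT x|lborel. (cmod (g (of_real x)))\<^sup>2)"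
  have cont: "continuous_on A g" for A
    using holomorphic_on_imp_continuous_on[OF hol] continuous_on_subset by blast
  obtain G where G: "\<And>z. (G has_field_derivative g z) (at z)"
    using holomorphic_convex_primitive[of UNIV "{}" g] cont hol
    by (auto simp: holomorphic_on_def)
  have holG: "G holomorphic_on UNIV"
    using G by (auto simp: holomorphic_on_def field_differentiable_def)
  define P where "P = (\<lambda>z. if z = 0 then deriv G 0 else (G z - G 0) / (z - 0))"
  have holP: "P holomorphic_on UNIV" unfolding P_def by (rule pole_lemma_open[OF holG open_UNIV])
  have GP: "G z - G 0 = z * P z" for z by (simp add: P_def)
  have \<tau>0: "\<tau> > 0" using \<open>\<tau> > pi\<close> pi_gt_zero by linarith
  obtain C where C: "C > 0" "\<And>z. cmod (g z) \<le> C * exp (\<tau> * cmod z)"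
    using ty \<open>\<tau> > pi\<close> unfolding exponential_type_le_def by (auto dest!: spec[of _ "\<tau> - pi"])
  have diff: "cmod (G z - G 0) \<le> C * exp (\<tau> * cmod z) * cmod z" for z
  proof -
    have "cmod (G z - G 0) \<le> C * exp (\<tau> * cmod z) * cmod (z - 0)"
    proof (rule field_differentiable_bound[of "cball 0 (cmod z)" G g])
      show "cmod (g w) \<le> C * exp (\<tau> * cmod z)" if "w \<in> cball 0 (cmod z)" for w
        using C(2)[of w] that \<tau>0 C(1)
        by (intro order_trans[OF C(2)] mult_left_mono) auto
    qed (auto intro: has_field_derivative_at_within[OF G])
    then show ?thesis by simp
  qed
  have P0: "P 0 = g 0" using DERIV_imp_deriv[OF G[of 0]] by (simp add: P_def)
  have Pgr: "cmod (P z) \<le> C * exp (\<tau> * cmod z)" for z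
  proof (cases "z = 0")
    case True
    then show ?thesis using C(2)[of 0] P0 by simp
  next
    case False
    have "cmod (P z) * cmod z \<le> C * exp (\<tau> * cmod z) * cmod z"
      using diff[of z] unfolding GP by (simp add: norm_mult mult.commute)
    then show ?thesis using False by simp
  qed
  \<comment> \<open>From \<open>\<bar>g\<bar> \<le> (1 + \<bar>g\<bar>\<^sup>2) / 2\<close>; hence \<open>P\<close> is bounded on the real line, which need not be clear for \<open>g\<close>.\<close>
  have real_diff: "cmod (G (of_real v) - G (of_real u)) \<le> ((v - u) + N) / 2" if "u \<le> v" for u v
  proof -
    have hi: "((\<lambda>x. g (of_real x)) has_integral (G (of_real v) - G (of_real u))) {u..v}"
      using that by (intro fundamental_theorem_of_calculus)
        (auto intro!: has_vector_derivative_real_field has_field_derivative_at_within[OF G]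
          simp flip: has_real_derivative_iff_has_vector_derivative)
    have si: "set_integrable lborel {u..v} (\<lambda>x. (cmod (g (of_real x)))\<^sup>2)"
      using L2 unfolding set_integrable_def by (rule integrable_mult_indicator[rotated]) auto
    have "integral {u..v} (\<lambda>x. (cmod (g (of_real x)))\<^sup>2) = (LINT x:{u..v}|lborel. (cmod (g (of_real x)))\<^sup>2)"
      using set_borel_integral_eq_integral(2)[OF si] by simp
    also have "\<dots> \<le> N" unfolding N_def set_lebesgue_integral_def
      using si L2 unfolding set_integrable_def
      by (intro integral_mono) (auto simp: indicator_def)
    finally have le: "integral {u..v} (\<lambda>x. (cmod (g (of_real x)))\<^sup>2) \<le> N" .
    have "cmod (integral {u..v} (\<lambda>x. g (of_real x))) \<le> integral {u..v} (\<lambda>x. (1 + (cmod (g (of_real x)))\<^sup>2) / 2)"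
    proof (rule integral_norm_bound_integral)
      show "cmod (g (of_real x)) \<le> (1 + (cmod (g (of_real x)))\<^sup>2) / 2" for x
        using sum_squares_bound[of 1 "cmod (g (of_real x))"] by simp
      show "(\<lambda>x. (1 + (cmod (g (of_real x)))\<^sup>2) / 2) integrable_on {u..v}"
        by (intro integrable_continuous_real continuous_intros continuous_on_compose2[OF cont[of UNIV]]) auto
    qed (use hi in auto)
    also have "\<dots> = ((v - u) + integral {u..v} (\<lambda>x. (cmod (g (of_real x)))\<^sup>2)) / 2"
      using that set_borel_integral_eq_integral(1)[OF si]
      by (simp add: Henstock_Kurzweil_Integration.integral_add[OF integrable_const_ivl])
    finally show ?thesis using hi le by (simp add: integral_unique)
  qed
  have N0: "N \<ge> 0" unfolding N_def by simp
  define K where "K = max ((1 + N) / 2) (C * exp \<tau>)"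
  have PR: "cmod (P (of_real x)) \<le> K" for x
  proof (cases "\<bar>x\<bar> \<le> 1")
    case True
    have "cmod (P (of_real x)) \<le> C * exp (\<tau> * \<bar>x\<bar>)" using Pgr[of "of_real x"] by simp
    also have "\<dots> \<le> C * exp \<tau>" using True C(1) \<tau>0 by (intro mult_left_mono) auto
    finally show ?thesis unfolding K_def by simp
  next
    case False
    have "\<bar>x\<bar> * cmod (P (of_real x)) = cmod (G (of_real x) - G 0)"
      unfolding GP by (simp add: norm_mult)
    also have "\<dots> \<le> (\<bar>x\<bar> + N) / 2"
      using real_diff[of 0 x] real_diff[of x 0] by (cases "x \<ge> 0") (auto simp: norm_minus_commute)
    also have "\<dots> \<le> (\<bar>x\<bar> + N * \<bar>x\<bar>) / 2"
      using mult_left_mono[of 1 "\<bar>x\<bar>" N] False N0 by simp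
    also have "\<dots> = \<bar>x\<bar> * ((1 + N) / 2)" by (simp add: algebra_simps)
    finally have "cmod (P (of_real x)) \<le> (1 + N) / 2" using False by (subst (asm) mult_le_cancel_left) auto
    then show ?thesis unfolding K_def by linarith
  qed
  obtain M where M: "\<And>z. cmod (P z) \<le> M * exp (\<tau> * \<bar>Im z\<bar>)"
    using exp_type_bounded_on_reals[OF holP _ Pgr PR] \<tau>0 by auto
  have M0: "M \<ge> 0" using order_trans[OF norm_ge_zero M[of 0]] by simp
  have "cmod (g z) \<le> (M * exp \<tau>) * (1 + cmod z) * exp (\<tau> * \<bar>Im z\<bar>)" for z
  proof -
    \<comment> \<open>Cauchy's estimate on a unit disc recovers \<open>g\<close> as the derivative
      of \<open>G\<close>. Moving by distance 1 changes \<open>\<bar>Im z\<bar>\<close> by at most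
      1, whence the factor \<open>exp \<tau>\<close>.\<close>
    have "cmod ((deriv ^^ 1) (\<lambda>w. G w - G 0) z) \<le> fact 1 * ((M * exp \<tau>) * (1 + cmod z) * exp (\<tau> * \<bar>Im z\<bar>)) / 1 ^ 1"
    proof (rule Cauchy_inequality)
      show "(\<lambda>w. G w - G 0) holomorphic_on ball z 1"
        by (intro holomorphic_intros holomorphic_on_subset[OF holG]) auto
      show "continuous_on (cball z 1) (\<lambda>w. G w - G 0)"
        by (intro continuous_intros holomorphic_on_imp_continuous_on holomorphic_on_subset[OF holG]) auto
      fix w assume w: "cmod (z - w) = 1"
      have w1: "cmod w \<le> 1 + cmod z"
        using norm_triangle_ineq4[of z "z - w"] w by simp
      have w2: "\<bar>Im w\<bar> \<le> 1 + \<bar>Im z\<bar>"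
        using abs_Im_le_cmod[of "z - w"] w by simp
      have "\<tau> * \<bar>Im w\<bar> \<le> \<tau> * (1 + \<bar>Im z\<bar>)" using w2 \<tau>0 by simp
      then have "exp (\<tau> * \<bar>Im w\<bar>) \<le> exp \<tau> * exp (\<tau> * \<bar>Im z\<bar>)"
        by (simp add: algebra_simps flip: exp_add)
      then have "cmod (G w - G 0) \<le> (1 + cmod z) * (M * (exp \<tau> * exp (\<tau> * \<bar>Im z\<bar>)))"
        unfolding GP norm_mult using w1 M0
        by (intro mult_mono order_trans[OF M] mult_left_mono) auto
      then show "cmod (G w - G 0) \<le> (M * exp \<tau>) * (1 + cmod z) * exp (\<tau> * \<bar>Im z\<bar>)"
        by (simp add: mult_ac)
    qed auto
    moreover have "deriv (\<lambda>w. G w - G 0) z = g z"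
      by (rule DERIV_imp_deriv) (use DERIV_diff[OF G[of z] DERIV_const] in simp)
    ultimately show ?thesis by simp
  qed
  then show ?thesis using that by blast
qed

subsection \<open>Contour integrals\<close>

text \<open>The value of \<open>Q\<close> at \<open>0\<close> is the junk value \<open>0\<close> of a division by zero.\<close>

lemma half_plane_second_difference_limit:
  fixes U :: "complex \<Rightarrow> complex"
  assumes hol: "U holomorphic_on UNIV"
    and bound: "\<And>z. Im z \<ge> 0 \<Longrightarrow> cmod (U z) \<le> M"
  defines "Q \<equiv> (\<lambda>x::real. (U (of_real x) - U 0 - deriv U 0 * of_real x) / (of_real x)\<^sup>2)"
  shows "Q integrable_on {-real n..real n}"
    and "(\<lambda>n. integral {-real n..real n} Q) \<longlonglongrightarrow> \<i> * of_real pi * deriv U 0"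
proof -
  \<comment> \<open>Two removable singularities in a row: \<open>G\<close> is the entire function
    that extends the second difference quotient \<open>Q\<close> of \<open>U\<close> at 0.\<close>
  define G1 where "G1 = (\<lambda>z. if z = 0 then deriv U 0 else (U z - U 0) / (z - 0))"
  define G where "G = (\<lambda>z. if z = 0 then deriv G1 0 else (G1 z - G1 0) / (z - 0))"
  have "G1 holomorphic_on UNIV" unfolding G1_def by (rule pole_lemma_open[OF hol open_UNIV])
  then have holG: "G holomorphic_on UNIV" unfolding G_def by (rule pole_lemma_open[OF _ open_UNIV])
  have G: "G z = (U z - U 0 - deriv U 0 * z) / z\<^sup>2" if "z \<noteq> 0" for z
    using that by (simp add: G_def G1_def field_simps power2_eq_square)
  have M0: "M \<ge> 0" using order_trans[OF norm_ge_zero bound[of 0]] by simp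
  have step: "\<exists>I. (Q has_integral I) {-R..R} \<and> cmod (I - \<i> * of_real pi * deriv U 0) \<le> 2 * M * pi / R"
    if R: "R > 0" for R :: real
  proof -
    let ?l = "linepath (- of_real R) (of_real R) :: real \<Rightarrow> complex"
    let ?c = "part_circlepath 0 R 0 pi"
    obtain I1 where I1: "(G has_contour_integral I1) ?l"
      using contour_integrable_holomorphic_simple[OF holG open_UNIV, of ?l]
      by (auto simp: contour_integrable_on_def)
    obtain I2 where I2: "(G has_contour_integral I2) ?c"
      using contour_integrable_holomorphic_simple[OF holG open_UNIV, of ?c]
      by (auto simp: contour_integrable_on_def)
    have "(G has_contour_integral (I1 + I2)) (?l +++ ?c)"
      using I1 I2 by (intro has_contour_integral_join) auto
    moreover have "(G has_contour_integral 0) (?l +++ ?c)"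
      by (rule Cauchy_theorem_convex_simple[OF holG convex_UNIV])
         (auto intro!: valid_path_join simp: cis_conv_exp[symmetric])
    ultimately have I12: "I2 = - I1"
      using has_contour_integral_unique by (metis add_eq_0_iff)
    \<comment> \<open>On the semicircle \<open>G\<close> splits into (U(z) - U(0)) / z^2 and -U'(0)
      / z. The first is at most 2M / R^2 on an arc of length pi R; the second integrates exactly, by
      the value computed here. As the contour is closed, the integral over the segment is i pi U'(0)
      up to 2 M pi / R.\<close>
    have "((\<lambda>z. 1 / z) has_contour_integral (\<i> * of_real pi)) ?c"
    proof -
      have "((\<lambda>t::real. \<i>) has_integral (pi - 0) *\<^sub>R \<i>) {0..pi}"
        by (intro has_integral_const_real[THEN has_integral_eq_rhs]) auto
      moreover have "1 / (0 + of_real R * cis t) * of_real R * \<i> * cis t = \<i>" for t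
        using R by (simp add: field_simps)
      ultimately show ?thesis
        by (subst has_contour_integral_part_circlepath_iff) (simp_all only: pi_gt_zero, simp add: scaleR_conv_of_real mult.commute)
    qed
    from has_contour_integral_add[OF I2 has_contour_integral_lmul[OF this, of "deriv U 0"]]
    have I3: "((\<lambda>z. G z + deriv U 0 * (1 / z)) has_contour_integral (I2 + deriv U 0 * (\<i> * of_real pi))) ?c" .
    have "cmod (I2 + deriv U 0 * (\<i> * of_real pi)) \<le> (2 * M / R\<^sup>2) * R * (pi - 0)"
    proof (rule has_contour_integral_bound_part_circlepath[OF I3])
      fix z assume "z \<in> path_image ?c"
      then obtain t where t: "0 \<le> t" "t \<le> pi" "z = of_real R * cis t"
        by (auto simp: path_image_part_circlepath' closed_segment_eq_real_ivl)
      have zR: "cmod z = R" using t R by (simp add: norm_mult)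
      have "Im z \<ge> 0" using t R sin_ge_zero[of t] by simp
      then have "cmod (U z - U 0) \<le> 2 * M"
        using bound[of z] bound[of 0] norm_triangle_ineq4[of "U z" "U 0"] by simp
      moreover have "z \<noteq> 0" using zR R by auto
      then have "G z + deriv U 0 * (1 / z) = (U z - U 0) / z\<^sup>2"
        by (simp add: G field_simps power2_eq_square)
      ultimately show "cmod (G z + deriv U 0 * (1 / z)) \<le> 2 * M / R\<^sup>2"
        by (simp add: norm_divide norm_power zR divide_right_mono)
    qed (use R M0 in auto)
    moreover have "I2 + deriv U 0 * (\<i> * of_real pi) = - (I1 - \<i> * of_real pi * deriv U 0)"
      using I12 by simp
    ultimately have "cmod (I1 - \<i> * of_real pi * deriv U 0) \<le> 2 * M * pi / R"
      using R by (simp only: norm_minus_cancel) (simp add: power2_eq_square)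
    moreover have "((\<lambda>x. G (of_real x)) has_integral I1) {-R..R}"
      using I1 R by (subst (asm) has_contour_integral_linepath_Reals_iff) auto
    then have "(Q has_integral I1) {-R..R}"
      by (rule has_integral_spike_finite[of "{0}", rotated 2]) (auto simp: Q_def G)
    ultimately show ?thesis by blast
  qed
  show "Q integrable_on {-real n..real n}"
    using step[of "real n"] by (cases "n = 0") (auto simp: integrable_on_def)
  have "(\<lambda>n. integral {-real n..real n} Q - \<i> * of_real pi * deriv U 0) \<longlonglongrightarrow> 0"
  proof (rule Lim_null_comparison)
    show "\<forall>\<^sub>F n in sequentially. norm (integral {-real n..real n} Q - \<i> * of_real pi * deriv U 0) \<le> 2 * M * pi / real n"
    proof (rule eventually_mono[OF eventually_gt_at_top[of 0]])
      fix n :: nat assume "n > 0"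
      with step[of "real n"]
      show "norm (integral {-real n..real n} Q - \<i> * of_real pi * deriv U 0) \<le> 2 * M * pi / real n"
        by (auto simp: integral_unique)
    qed
    show "(\<lambda>n. 2 * M * pi / real n) \<longlonglongrightarrow> 0" by real_asymp
  qed
  then show "(\<lambda>n. integral {-real n..real n} Q) \<longlonglongrightarrow> \<i> * of_real pi * deriv U 0"
    by (simp add: LIM_zero_iff)
qed

text \<open>When \<open>\<tau>\<close> and \<open>W 0\<close> are nonzero the integrand decays only
  like 1/x, so the integral exists merely as a limit over symmetric intervals. The uses below remove
  that term, by \<open>W 0 = 0\<close> or by combining two values of \<open>\<tau>\<close>, and then
  pass to Lebesgue integrals through \<open>integral_symmetric_limit\<close>.\<close>

lemma riesz_integral_limit:
  fixes W :: "complex \<Rightarrow> complex"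
  assumes hol: "W holomorphic_on UNIV"
    and bound: "\<And>z. cmod (W z) \<le> M * exp (\<tau> * \<bar>Im z\<bar>)"
  defines "Q \<equiv> (\<lambda>x::real. (W (of_real x) * of_real (sin (\<tau> * x)) - of_real \<tau> * W 0 * of_real x) / (of_real x)\<^sup>2)"
  shows "Q integrable_on {-real n..real n}"
    and "(\<lambda>n. integral {-real n..real n} Q) \<longlonglongrightarrow> of_real pi * deriv W 0"
proof -
  \<comment> \<open>Half-plane limits for \<open>W\<close> (upper) and for its reflection (lower); the difference of the two
    exponential factors is \<open>2 \<i> sin (\<tau> x)\<close>.\<close>
  define e where "e = (\<lambda>z. exp (\<i> * of_real \<tau> * z))"
  define U where "U = (\<lambda>z. W z * e z)"
  define V where "V = (\<lambda>z. W (- z) * e z)"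
  have DW: "(W has_field_derivative deriv W z) (at z)" for z
    using hol holomorphic_derivI open_UNIV by blast
  have De: "(e has_field_derivative \<i> * of_real \<tau> * e z) (at z)" for z
    unfolding e_def by (auto intro!: derivative_eq_intros)
  have holU: "U holomorphic_on UNIV" unfolding U_def e_def by (intro holomorphic_intros hol)
  have holW': "(\<lambda>z. W (- z)) holomorphic_on UNIV"
    by (intro entire_compose[OF hol] holomorphic_intros)
  have holV: "V holomorphic_on UNIV" unfolding V_def e_def by (intro holomorphic_intros holW')
  have e0: "e 0 = 1" by (simp add: e_def)
  have dU: "deriv U 0 = deriv W 0 + \<i> * of_real \<tau> * W 0"
    unfolding U_def using DERIV_mult[OF DW[of 0] De[of 0]] by (intro DERIV_imp_deriv) (simp add: e0 mult.commute)
  have "((\<lambda>z. W (- z)) has_field_derivative (deriv W 0 * (-1))) (at 0)"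
    by (rule DERIV_chain2[where g=uminus]) (use DW[of 0] in \<open>auto intro!: derivative_eq_intros\<close>)
  from DERIV_mult[OF this De[of 0]]
  have dV: "deriv V 0 = - deriv W 0 + \<i> * of_real \<tau> * W 0"
    unfolding V_def by (intro DERIV_imp_deriv) (simp add: e0 mult.commute)
  have ne: "cmod (e z) = exp (- \<tau> * Im z)" for z by (simp add: e_def)
  have bU: "cmod (U z) \<le> M" if "Im z \<ge> 0" for z
    using bound[of z] that unfolding U_def norm_mult ne by (simp add: exp_minus field_simps)
  have bV: "cmod (V z) \<le> M" if "Im z \<ge> 0" for z
    using bound[of "- z"] that unfolding V_def norm_mult ne by (simp add: exp_minus field_simps)
  define QU where "QU = (\<lambda>x::real. (U (of_real x) - U 0 - deriv U 0 * of_real x) / (of_real x)\<^sup>2)"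
  define QV where "QV = (\<lambda>x::real. (V (of_real x) - V 0 - deriv V 0 * of_real x) / (of_real x)\<^sup>2)"
  note LU = half_plane_second_difference_limit[OF holU bU, folded QU_def]
  note LV = half_plane_second_difference_limit[OF holV bV, folded QV_def]
  have reflI: "(\<lambda>x. QV (- x)) integrable_on {-real n..real n}" for n
    using LV(1)[of n] Henstock_Kurzweil_Integration.integrable_reflect_real[of QV "real n" "- real n"] by simp
  have refl: "integral {-real n..real n} (\<lambda>x. QV (- x)) = integral {-real n..real n} QV" for n
    using Henstock_Kurzweil_Integration.integral_reflect_real[of "real n" "- real n" QV] by simp
  have Q: "Q = (\<lambda>x. (QU x - QV (- x)) / (2 * \<i>))"
  proof
    fix x :: real
    have "e (of_real x) = cis (\<tau> * x)" "e (of_real (- x)) = cis (- (\<tau> * x))"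
      by (simp_all add: e_def cis_conv_exp mult_ac)
    then have s: "e (of_real x) - e (of_real (- x)) = 2 * \<i> * of_real (sin (\<tau> * x))"
      by (simp add: complex_eq_iff)
    have "QU x = (W (of_real x) * e (of_real x) - W 0 - (deriv W 0 + \<i> * of_real \<tau> * W 0) * of_real x) / (of_real x)\<^sup>2"
      unfolding QU_def dU by (simp add: U_def e0)
    moreover have "QV (- x) = (W (of_real x) * e (of_real (- x)) - W 0 - (- deriv W 0 + \<i> * of_real \<tau> * W 0) * of_real (- x)) / (of_real x)\<^sup>2"
      unfolding QV_def dV by (simp add: V_def e0)
    ultimately have "QU x - QV (- x) = (W (of_real x) * (e (of_real x) - e (of_real (- x))) - 2 * \<i> * of_real \<tau> * W 0 * of_real x) / (of_real x)\<^sup>2"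
      by (simp only: diff_divide_distrib[symmetric]) (simp add: algebra_simps)
    moreover have "W (of_real x) * (2 * \<i> * of_real (sin (\<tau> * x))) - 2 * \<i> * of_real \<tau> * W 0 * of_real x
        = 2 * \<i> * (W (of_real x) * of_real (sin (\<tau> * x)) - of_real \<tau> * W 0 * of_real x)"
      by (simp add: algebra_simps)
    ultimately have "QU x - QV (- x) = 2 * \<i> * Q x" by (simp only: s Q_def times_divide_eq_right)
    then show "Q x = (QU x - QV (- x)) / (2 * \<i>)" by simp
  qed
  show "Q integrable_on {-real n..real n}"
    unfolding Q using LU(1)[of n] reflI[of n]
    by (intro integrable_on_divide Henstock_Kurzweil_Integration.integrable_diff)
  have "integral {-real n..real n} Q = (integral {-real n..real n} QU - integral {-real n..real n} QV) / (2 * \<i>)" for n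
    unfolding Q using LU(1)[of n] reflI[of n]
    by (simp add: Henstock_Kurzweil_Integration.integral_diff refl)
  moreover have "(\<lambda>n. (integral {-real n..real n} QU - integral {-real n..real n} QV) / (2 * \<i>)) \<longlonglongrightarrow>
      (\<i> * of_real pi * deriv U 0 - \<i> * of_real pi * deriv V 0) / (2 * \<i>)"
    by (intro tendsto_intros LU(2) LV(2)) auto
  moreover have "(\<i> * of_real pi * deriv U 0 - \<i> * of_real pi * deriv V 0) / (2 * \<i>) = of_real pi * deriv W 0"
    unfolding dU dV by (simp add: field_simps)
  ultimately show "(\<lambda>n. integral {-real n..real n} Q) \<longlonglongrightarrow> of_real pi * deriv W 0" by simp
qed

lemma integral_symmetric_limit:
  fixes f :: "real \<Rightarrow> 'a::euclidean_space"
  assumes f: "integrable lborel f"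
  shows "(\<lambda>n. integral {-real n..real n} f) \<longlonglongrightarrow> (LINT x|lborel. f x)"
proof -
  have si: "set_integrable lborel {-real n..real n} f" for n
    using f unfolding set_integrable_def by (rule integrable_mult_indicator[rotated]) auto
  have eq: "integral {-real n..real n} f = (LINT x|lborel. indicator {-real n..real n} x *\<^sub>R f x)" for n
    using set_borel_integral_eq_integral(2)[OF si] by (simp add: set_lebesgue_integral_def)
  show ?thesis unfolding eq
  proof (rule integral_dominated_convergence[where w="\<lambda>x. norm (f x)"])
    show "AE x in lborel. (\<lambda>n. indicator {-real n..real n} x *\<^sub>R f x) \<longlonglongrightarrow> f x"
    proof (intro AE_I2 tendsto_eventually)
      fix x :: real
      obtain k :: nat where k: "\<bar>x\<bar> \<le> real k" using real_arch_simple by blast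
      show "\<forall>\<^sub>F n in sequentially. indicator {-real n..real n} x *\<^sub>R f x = f x"
        by (rule eventually_mono[OF eventually_ge_at_top[of k]]) (use k in \<open>auto simp: indicator_def\<close>)
    qed
    show "AE x in lborel. norm (indicator {-real n..real n} x *\<^sub>R f x) \<le> norm (f x)" for n
      by (auto simp: indicator_def)
    show "(\<lambda>x. indicator {-real n..real n} x *\<^sub>R f x) \<in> borel_measurable lborel" for n
      using si[of n] unfolding set_integrable_def by (rule borel_measurable_integrable)
  qed (use f in auto)
qed

subsection \<open>The reproducing property and square integrability of the derivative\<close>

lemma sin_linear_entire:
  "(\<lambda>z. sin (of_real \<delta> * z) / of_real \<delta> :: complex) holomorphic_on UNIV"
  by (cases "\<delta> = 0") (auto intro!: holomorphic_intros)

definition csinc :: "real \<Rightarrow> complex \<Rightarrow> complex" where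
  "csinc \<delta> z = (if z = 0 then 1 else sin (of_real \<delta> * z) / (of_real \<delta> * z))"

lemma csinc_0 [simp]: "csinc \<delta> 0 = 1"
  by (simp add: csinc_def)

lemma holomorphic_csinc:
  assumes "\<delta> \<noteq> 0"
  shows "csinc \<delta> holomorphic_on UNIV"
proof -
  define s where "s = (\<lambda>z::complex. sin (of_real \<delta> * z) / of_real \<delta>)"
  have "(s has_field_derivative cos (of_real \<delta> * 0)) (at 0)"
    unfolding s_def using assms by (auto intro!: derivative_eq_intros)
  then have "deriv s 0 = 1" by (simp add: DERIV_imp_deriv)
  then have "csinc \<delta> = (\<lambda>z. if z = 0 then deriv s 0 else (s z - s 0) / (z - 0))"
    by (auto simp: csinc_def s_def fun_eq_iff)
  moreover have "\<dots> holomorphic_on UNIV"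
    unfolding s_def by (intro pole_lemma_open sin_linear_entire open_UNIV)
  ultimately show ?thesis by simp
qed

text \<open>The function is even. Together with \<open>csinc_0\<close> this means that
  multiplication by \<open>csinc \<delta>\<close> preserves both the value and the derivative at
  0.\<close>

lemma deriv_csinc_0:
  assumes "\<delta> \<noteq> 0"
  shows "(csinc \<delta> has_field_derivative 0) (at 0)"
proof -
  obtain d where d: "(csinc \<delta> has_field_derivative d) (at 0)"
    using holomorphic_csinc[OF assms] by (auto simp: holomorphic_on_def field_differentiable_def)
  have "((\<lambda>z. csinc \<delta> (- z)) has_field_derivative d * (-1)) (at 0)"
    by (rule DERIV_chain2[where g=uminus]) (use d in \<open>auto intro!: derivative_eq_intros\<close>)
  moreover have "(\<lambda>z. csinc \<delta> (- z)) = csinc \<delta>"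
    by (auto simp: csinc_def fun_eq_iff)
  ultimately have "(csinc \<delta> has_field_derivative d * (-1)) (at 0)" by (simp only:)
  from DERIV_unique[OF d this] have "d = 0" by simp
  then show ?thesis using d by simp
qed

text \<open>The weight \<open>1 + cmod z\<close> is exactly the factor left over in
  \<open>PW2_growth\<close>. Near 0 compactness suffices; outside the unit disc the denominator pays
  for the weight.\<close>

lemma csinc_growth:
  assumes "\<delta> > 0"
  obtains C where "\<And>z. (1 + cmod z) * cmod (csinc \<delta> z) \<le> C * exp (\<delta> * \<bar>Im z\<bar>)"
proof -
  have "compact (csinc \<delta> ` cball 0 1)"
    using assms
    by (intro compact_continuous_image holomorphic_on_imp_continuous_on
        holomorphic_on_subset[OF holomorphic_csinc]) auto
  then obtain B where B: "\<And>z. cmod z \<le> 1 \<Longrightarrow> cmod (csinc \<delta> z) \<le> B"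
    by (meson bounded_iff compact_imp_bounded imageI mem_cball_0)
  define C where "C = max (2 * B) (2 / \<delta>)"
  have "B \<ge> 0" using order_trans[OF norm_ge_zero B[of 0]] by simp
  have "(1 + cmod z) * cmod (csinc \<delta> z) \<le> C * exp (\<delta> * \<bar>Im z\<bar>)" for z
  proof (cases "cmod z \<le> 1")
    case True
    then have "(1 + cmod z) * cmod (csinc \<delta> z) \<le> 2 * B"
      using B[of z] by (intro mult_mono) auto
    also have "\<dots> \<le> C * 1" by (simp add: C_def)
    also have "\<dots> \<le> C * exp (\<delta> * \<bar>Im z\<bar>)"
      using assms \<open>B \<ge> 0\<close> by (intro mult_left_mono) (auto simp: C_def)
    finally show ?thesis .
  next
    case False
    have "cmod (sin (of_real \<delta> * z)) \<le> exp (\<delta> * \<bar>Im z\<bar>)"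
      using cmod_sin_le_exp[of 1 "of_real \<delta> * z"] assms by (simp add: abs_mult)
    moreover have "(1 + cmod z) * cmod (csinc \<delta> z) = ((1 + cmod z) / cmod z) * (cmod (sin (of_real \<delta> * z)) / \<delta>)"
      using False assms by (auto simp: csinc_def norm_divide norm_mult)
    moreover have "(1 + cmod z) / cmod z \<le> 2" using False by (simp add: divide_le_eq)
    ultimately have "(1 + cmod z) * cmod (csinc \<delta> z) \<le> 2 * (exp (\<delta> * \<bar>Im z\<bar>) / \<delta>)"
      using assms by (simp only:) (intro mult_mono divide_right_mono; simp)
    also have "\<dots> = (2 / \<delta>) * exp (\<delta> * \<bar>Im z\<bar>)" by simp
    also have "\<dots> \<le> C * exp (\<delta> * \<bar>Im z\<bar>)"
      by (intro mult_right_mono) (auto simp: C_def)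
    finally show ?thesis .
  qed
  then show ?thesis using that by blast
qed

lemma cmod_csinc_real_le: "cmod (csinc \<delta> (of_real x)) \<le> 1"
proof (cases "\<delta> * x = 0")
  case False
  have "cmod (sin (of_real (\<delta> * x))) \<le> \<bar>\<delta> * x\<bar>"
    using abs_sin_x_le_abs_x[of "\<delta> * x"] by (simp only: sin_of_real norm_of_real)
  then show ?thesis using False by (simp add: csinc_def norm_divide norm_mult abs_mult)
qed (auto simp: csinc_def)

lemma integrable_inverse_1_plus_square: "integrable lborel (\<lambda>x::real. 1 / (1 + x\<^sup>2))"
proof -
  have "set_integrable lborel (einterval (-\<infinity>) \<infinity>) (\<lambda>x::real. 1 / (1 + x\<^sup>2))"
  proof (rule interval_integral_FTC_nonneg[where F=arctan and A="-pi/2" and B="pi/2"])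
    show "((arctan \<circ> real_of_ereal) \<longlongrightarrow> - pi / 2) (at_right (- \<infinity>))"
      by (simp add: ereal_tendsto_simps1 tendsto_arctan_at_bot)
    show "((arctan \<circ> real_of_ereal) \<longlongrightarrow> pi / 2) (at_left \<infinity>)"
      by (simp add: ereal_tendsto_simps1 tendsto_arctan_at_top)
    show "DERIV arctan x :> 1 / (1 + x\<^sup>2)" for x
      using DERIV_arctan[of x] by (simp add: inverse_eq_divide)
    show "isCont (\<lambda>x::real. 1 / (1 + x\<^sup>2)) x" for x
      by (intro continuous_intros) (auto simp: add_nonneg_eq_0_iff)
  qed auto
  then show ?thesis by (simp add: set_integrable_def)
qed

text \<open>Combines |sin u| \<le> 1 and |sin u| \<le> |u|. At \<open>x = 0\<close> the left side is
  0 by division by zero. The bound is uniform for \<open>\<tau>\<close> in a bounded range, which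
  dominated convergence will need.\<close>

lemma sin_over_square_le: "(sin (\<tau> * x) / x)\<^sup>2 \<le> (1 + \<tau>\<^sup>2) / (1 + x\<^sup>2)" for x :: real
proof (cases "x = 0")
  case False
  have 1: "(sin (\<tau> * x))\<^sup>2 \<le> 1" by (simp add: abs_square_le_1)
  have 2: "(sin (\<tau> * x))\<^sup>2 \<le> (\<tau> * x)\<^sup>2"
    using abs_sin_x_le_abs_x[of "\<tau> * x"] by (simp add: abs_le_square_iff)
  have "(sin (\<tau> * x))\<^sup>2 * (1 + x\<^sup>2) = (sin (\<tau> * x))\<^sup>2 + (sin (\<tau> * x))\<^sup>2 * x\<^sup>2" by (simp add: algebra_simps)
  also have "\<dots> \<le> (\<tau> * x)\<^sup>2 + 1 * x\<^sup>2" by (intro add_mono 2 mult_right_mono 1) auto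
  also have "\<dots> = (1 + \<tau>\<^sup>2) * x\<^sup>2" by (simp add: algebra_simps)
  finally have 3: "(sin (\<tau> * x))\<^sup>2 * (1 + x\<^sup>2) \<le> (1 + \<tau>\<^sup>2) * x\<^sup>2" .
  have "0 < 1 + x\<^sup>2" by (simp add: add_pos_nonneg)
  then show ?thesis using False 3 by (simp add: power_divide divide_le_eq pos_le_divide_eq mult.commute)
qed (auto)

lemma mult_le_half_sum_squares: "a * b \<le> (a\<^sup>2 + b\<^sup>2) / 2" for a b :: real
  using sum_squares_bound[of a b] by simp

lemma entire_borel_measurable_of_real:
  fixes f :: "complex \<Rightarrow> complex"
  assumes "f holomorphic_on UNIV"
  shows "(\<lambda>x. f (of_real x)) \<in> borel_measurable borel"
  by (intro borel_measurable_continuous_onI continuous_on_compose2[OF holomorphic_on_imp_continuous_on[OF assms]]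
      continuous_intros) auto

lemma PW2_D:
  assumes "g \<in> PW2"
  shows "g holomorphic_on UNIV" "exponential_type_le pi g"
    "integrable lborel (\<lambda>x::real. (cmod (g (of_real x)))\<^sup>2)"
    "continuous_on A g" "(g has_field_derivative deriv g z) (at z)"
    "(\<lambda>x. g (of_real x)) \<in> borel_measurable borel"
proof -
  show hol: "g holomorphic_on UNIV" and "exponential_type_le pi g"
    and "integrable lborel (\<lambda>x::real. (cmod (g (of_real x)))\<^sup>2)"
    using assms by (auto simp: PW2_def)
  show "continuous_on A g" using holomorphic_on_imp_continuous_on[OF hol] continuous_on_subset by blast
  show "(g has_field_derivative deriv g z) (at z)" using hol holomorphic_derivI open_UNIV by blast
  show "(\<lambda>x. g (of_real x)) \<in> borel_measurable borel"
    by (rule entire_borel_measurable_of_real[OF hol])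
qed

section \<open>The reproducing formula at the origin\<close>

lemma PW2_times_csinc_bound:
  assumes g: "g \<in> PW2" and "\<delta> > 0" and "\<tau> > pi + \<delta>"
  obtains M where "\<And>z. cmod (g z * csinc \<delta> z) \<le> M * exp (\<tau> * \<bar>Im z\<bar>)"
proof -
  obtain C1 where C1: "\<And>z. cmod (g z) \<le> C1 * (1 + cmod z) * exp ((\<tau> - \<delta>) * \<bar>Im z\<bar>)"
    using PW2_growth[OF g, of "\<tau> - \<delta>"] assms by auto
  obtain C2 where C2: "\<And>z. (1 + cmod z) * cmod (csinc \<delta> z) \<le> C2 * exp (\<delta> * \<bar>Im z\<bar>)"
    using csinc_growth[OF \<open>\<delta> > 0\<close>] by auto
  have C10: "C1 \<ge> 0" using order_trans[OF norm_ge_zero C1[of 0]] by simp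
  have "cmod (g z * csinc \<delta> z) \<le> (C1 * C2) * exp (\<tau> * \<bar>Im z\<bar>)" for z
  proof -
    have "cmod (g z * csinc \<delta> z) \<le> (C1 * (1 + cmod z) * exp ((\<tau> - \<delta>) * \<bar>Im z\<bar>)) * cmod (csinc \<delta> z)"
      unfolding norm_mult by (intro mult_right_mono C1) auto
    also have "\<dots> = C1 * exp ((\<tau> - \<delta>) * \<bar>Im z\<bar>) * ((1 + cmod z) * cmod (csinc \<delta> z))" by (simp add: mult_ac)
    also have "\<dots> \<le> C1 * exp ((\<tau> - \<delta>) * \<bar>Im z\<bar>) * (C2 * exp (\<delta> * \<bar>Im z\<bar>))"
      using C10 by (intro mult_left_mono C2) auto
    also have "\<dots> = (C1 * C2) * exp (\<tau> * \<bar>Im z\<bar>)"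
      by (simp add: left_diff_distrib exp_diff)
    finally show ?thesis .
  qed
  then show ?thesis using that by blast
qed

text \<open>The value 0 of \<open>sin (pi * x) / x\<close> at \<open>x = 0\<close>, in place of pi,
  affects a null set only.\<close>

lemma PW2_reproducing:
  assumes g: "g \<in> PW2"
  defines "K \<equiv> \<lambda>x::real. g (of_real x) * of_real (sin (pi * x) / x)"
  shows "integrable lborel K" and "(LINT x|lborel. K x) = of_real pi * g 0"
proof -
  note [measurable] = PW2_D(6)[OF g]
  \<comment> \<open>Two factors \<open>csinc \<delta>\<close> make the product with \<open>z\<close> bounded on horizontal lines, at the price of
    enlarging the type beyond \<open>\<pi>\<close>; dominated convergence removes them as \<open>\<delta>\<close> tends to \<open>0\<close>.\<close>
  define \<delta> where "\<delta> = (\<lambda>n. 1 / real (Suc n))"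
  \<comment> \<open>The two sinc factors use up \<open>2 * \<delta> n\<close> of the type; the third
    \<open>\<delta> n\<close> keeps the inequality required by \<open>PW2_times_csinc_bound\<close>
    strict.\<close>
  define \<tau> where "\<tau> = (\<lambda>n. pi + 3 * \<delta> n)"
  define S where "S = (\<lambda>n (x::real). g (of_real x) * csinc (\<delta> n) (of_real x) ^ 2 * of_real (sin (\<tau> n * x) / x))"
  \<comment> \<open>One majorant for all \<open>n\<close>: 8 exceeds every \<open>\<tau> n\<close>,
    because pi < 4 and \<open>\<delta> n \<le> 1\<close>.\<close>
  define w where "w = (\<lambda>x::real. ((cmod (g (of_real x)))\<^sup>2 + (1 + 8\<^sup>2) * (1 / (1 + x\<^sup>2))) / 2)"
  have \<delta>: "\<delta> n > 0" "\<delta> n \<le> 1" for n by (auto simp: \<delta>_def)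
  have \<tau>: "0 < \<tau> n" "\<tau> n \<le> 8" "pi + 2 * \<delta> n < \<tau> n" for n
    using pi_gt3 pi_less_4 \<delta>[of n] unfolding \<tau>_def by linarith+
  have w: "integrable lborel w" unfolding w_def
    using PW2_D(3)[OF g] integrable_inverse_1_plus_square
    by (intro integrable_divide Bochner_Integration.integrable_add integrable_mult_right) auto
  have bound: "cmod (S n x) \<le> w x" for n x
  proof -
    have "cmod (S n x) \<le> cmod (g (of_real x)) * 1 ^ 2 * \<bar>sin (\<tau> n * x) / x\<bar>"
      unfolding S_def norm_mult norm_power norm_of_real
      by (intro mult_right_mono mult_left_mono power_mono cmod_csinc_real_le) auto
    also have "\<dots> \<le> ((cmod (g (of_real x)))\<^sup>2 + (sin (\<tau> n * x) / x)\<^sup>2) / 2"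
      using mult_le_half_sum_squares[of "cmod (g (of_real x))" "\<bar>sin (\<tau> n * x) / x\<bar>"]
      by (simp only: power2_abs power_one mult_1_right)
    also have "\<dots> \<le> w x"
    proof -
      have "(sin (\<tau> n * x) / x)\<^sup>2 \<le> (1 + (\<tau> n)\<^sup>2) / (1 + x\<^sup>2)" by (rule sin_over_square_le)
      also have "\<dots> \<le> (1 + 8\<^sup>2) / (1 + x\<^sup>2)"
        using \<tau>[of n] by (intro divide_right_mono add_left_mono power_mono) (auto simp: add_nonneg_nonneg)
      finally show ?thesis by (simp add: w_def)
    qed
    finally show ?thesis .
  qed
  have meas_snc[measurable]: "(\<lambda>x. csinc (\<delta> n) (of_real x)) \<in> borel_measurable borel" for n
    using \<delta>[of n] by (intro entire_borel_measurable_of_real holomorphic_csinc) simp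
  have meas_S: "S n \<in> borel_measurable lborel" for n unfolding S_def by measurable
  have meas_K: "K \<in> borel_measurable lborel" unfolding K_def by measurable
  have lim: "(\<lambda>n. S n x) \<longlonglongrightarrow> K x" for x
  proof (cases "x = 0")
    case False
    have \<delta>0: "\<delta> \<longlonglongrightarrow> 0" unfolding \<delta>_def by real_asymp
    have "((\<lambda>d. sin (d * x) / (d * x)) \<longlongrightarrow> 1) (at_right 0)"
      using False by real_asymp
    then have "((\<lambda>d. complex_of_real (sin (d * x) / (d * x))) \<longlongrightarrow> of_real 1) (at_right 0)"
      by (rule tendsto_of_real)
    moreover have "filterlim \<delta> (at_right 0) sequentially"
      unfolding \<delta>_def by real_asymp
    ultimately have "(\<lambda>n. complex_of_real (sin (\<delta> n * x) / (\<delta> n * x))) \<longlonglongrightarrow> of_real 1"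
      by (rule filterlim_compose)
    moreover have "csinc (\<delta> n) (of_real x) = complex_of_real (sin (\<delta> n * x) / (\<delta> n * x))" for n
      using False by (simp add: csinc_def flip: sin_of_real)
    ultimately have 1: "(\<lambda>n. csinc (\<delta> n) (of_real x)) \<longlonglongrightarrow> 1" by simp
    have "(\<lambda>n. S n x) \<longlonglongrightarrow> g (of_real x) * 1 ^ 2 * of_real (sin ((pi + 3 * 0) * x) / x)"
      unfolding S_def \<tau>_def by (intro tendsto_intros 1 \<delta>0 False)
    then show ?thesis by (simp add: K_def)
  qed (simp add: S_def K_def)
  show "integrable lborel K"
    using integrable_dominated_convergence[OF meas_K meas_S w AE_I2[OF lim] AE_I2[OF bound]] by simp
  have conv: "(\<lambda>n. LINT x|lborel. S n x) \<longlonglongrightarrow> (LINT x|lborel. K x)"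
    using integral_dominated_convergence[OF meas_K meas_S w AE_I2[OF lim] AE_I2[OF bound]] by simp
  \<comment> \<open>The regularised formula is exact for each \<open>n\<close>, so the limit in
    \<open>conv\<close> is that of a constant sequence.\<close>
  have "(LINT x|lborel. S n x) = of_real pi * g 0" for n
  proof -
    \<comment> \<open>The second sinc factor enters as sin(\<delta> z) / \<delta>, that is, z times
      the sinc. The zero at 0 kills the 1/x term of \<open>riesz_integral_limit\<close> and makes
      \<open>deriv W 0\<close> equal to \<open>g 0\<close>; dividing by x^2 then restores the
      integrand \<open>S n\<close>.\<close>
    define W where "W = (\<lambda>z. g z * csinc (\<delta> n) z * (sin (of_real (\<delta> n) * z) / of_real (\<delta> n)))"
    have holW: "W holomorphic_on UNIV" unfolding W_def
      using \<delta>[of n] by (intro holomorphic_intros PW2_D(1)[OF g] holomorphic_csinc sin_linear_entire) auto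
    obtain M where M: "\<And>z. cmod (g z * csinc (\<delta> n) z) \<le> M * exp ((\<tau> n - \<delta> n) * \<bar>Im z\<bar>)"
      using PW2_times_csinc_bound[OF g \<delta>(1), of n "\<tau> n - \<delta> n"] \<tau>[of n] by auto
    have "M \<ge> 0" using order_trans[OF norm_ge_zero M[of 0]] by simp
    have bW: "cmod (W z) \<le> (M / \<delta> n) * exp (\<tau> n * \<bar>Im z\<bar>)" for z
    proof -
      have "cmod (sin (of_real (\<delta> n) * z)) \<le> exp (\<delta> n * \<bar>Im z\<bar>)"
        using cmod_sin_le_exp[of 1 "of_real (\<delta> n) * z"] \<delta>[of n] by (simp add: abs_mult)
      then have "cmod (sin (of_real (\<delta> n) * z) / of_real (\<delta> n)) \<le> exp (\<delta> n * \<bar>Im z\<bar>) / \<delta> n"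
        using \<delta>[of n] by (simp add: norm_divide divide_right_mono)
      then have "cmod (W z) \<le> (M * exp ((\<tau> n - \<delta> n) * \<bar>Im z\<bar>)) * (exp (\<delta> n * \<bar>Im z\<bar>) / \<delta> n)"
        unfolding W_def norm_mult[of _ "sin (of_real (\<delta> n) * z) / of_real (\<delta> n)"]
        using \<open>M \<ge> 0\<close> by (intro mult_mono M) auto
      also have "\<dots> = (M / \<delta> n) * exp (\<tau> n * \<bar>Im z\<bar>)" by (simp add: left_diff_distrib exp_diff)
      finally show ?thesis .
    qed
    have W0: "W 0 = 0" by (simp add: W_def)
    have "((\<lambda>z. sin (of_real (\<delta> n) * z) / of_real (\<delta> n)) has_field_derivative cos (of_real (\<delta> n) * 0)) (at (0::complex))"
      using \<delta>[of n] by (auto intro!: derivative_eq_intros)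
    from DERIV_mult[OF DERIV_mult[OF PW2_D(5)[OF g, of 0] deriv_csinc_0[of "\<delta> n"]] this]
    have dW: "deriv W 0 = g 0" unfolding W_def using \<delta>[of n] by (intro DERIV_imp_deriv) simp
    have SW: "(W (of_real x) * of_real (sin (\<tau> n * x)) - of_real (\<tau> n) * W 0 * of_real x) / (of_real x)\<^sup>2 = S n x" for x
      using \<delta>[of n] by (simp add: W0, simp add: W_def S_def csinc_def power2_eq_square mult_ac)
    have "integrable lborel (S n)"
      using integrable_dominated_convergence2[OF meas_K meas_S w AE_I2[OF lim] AE_I2[OF bound]] by simp
    from integral_symmetric_limit[OF this] riesz_integral_limit(2)[OF holW bW]
    show ?thesis unfolding SW dW by (metis LIMSEQ_unique)
  qed
  with conv show "(LINT x|lborel. K x) = of_real pi * g 0"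
    by (simp add: LIMSEQ_const_iff)
qed

lemma mult_le_square_plus:
  fixes a b c :: real
  assumes "b\<^sup>2 \<le> c"
  shows "a * b \<le> a\<^sup>2 + c"
proof -
  have half: "x / 2 \<le> x" if "0 \<le> x" for x :: real using that by simp
  have "a * b \<le> (a\<^sup>2 + b\<^sup>2) / 2" by (rule mult_le_half_sum_squares)
  also have "\<dots> \<le> a\<^sup>2 + b\<^sup>2" by (rule half) simp
  also have "\<dots> \<le> a\<^sup>2 + c" using assms by simp
  finally show ?thesis .
qed

section \<open>Bounds on the whole real line by translation\<close>

lemma PW2_translate:
  assumes g: "g \<in> PW2"
  shows "(\<lambda>z. g (of_real t + z)) \<in> PW2"
proof -
  have "\<exists>C>0. \<forall>z. cmod (g (of_real t + z)) \<le> C * exp ((pi + \<epsilon>) * cmod z)" if \<epsilon>: "\<epsilon> > 0" for \<epsilon>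
  proof -
    obtain C where C: "C > 0" "\<And>z. cmod (g z) \<le> C * exp ((pi + \<epsilon>) * cmod z)"
      using PW2_D(2)[OF g] \<epsilon> unfolding exponential_type_le_def by blast
    have "cmod (g (of_real t + z)) \<le> (C * exp ((pi + \<epsilon>) * \<bar>t\<bar>)) * exp ((pi + \<epsilon>) * cmod z)" for z
    proof -
      have "(pi + \<epsilon>) * cmod (of_real t + z) \<le> (pi + \<epsilon>) * (\<bar>t\<bar> + cmod z)"
        using norm_triangle_ineq[of "of_real t" z] \<epsilon> by (intro mult_left_mono) auto
      then have "exp ((pi + \<epsilon>) * cmod (of_real t + z)) \<le> exp ((pi + \<epsilon>) * \<bar>t\<bar>) * exp ((pi + \<epsilon>) * cmod z)"
        by (simp add: algebra_simps flip: exp_add)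
      then have "C * exp ((pi + \<epsilon>) * cmod (of_real t + z)) \<le> C * (exp ((pi + \<epsilon>) * \<bar>t\<bar>) * exp ((pi + \<epsilon>) * cmod z))"
        using C(1) by (intro mult_left_mono) auto
      with C(2)[of "of_real t + z"] show ?thesis by (simp add: mult.assoc)
    qed
    moreover have "C * exp ((pi + \<epsilon>) * \<bar>t\<bar>) > 0" using C(1) by simp
    ultimately show ?thesis by blast
  qed
  moreover have "(\<lambda>z. g (of_real t + z)) holomorphic_on UNIV"
    by (intro entire_compose[OF PW2_D(1)[OF g]] holomorphic_intros)
  moreover have "integrable lborel (\<lambda>x::real. (cmod (g (of_real (t + 1 * x))))\<^sup>2)"
    by (rule lborel_integrable_real_affine[OF PW2_D(3)[OF g]]) simp
  ultimately show ?thesis by (simp add: PW2_def exponential_type_le_def)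
qed

lemma lborel_integral_translate:
  fixes f :: "real \<Rightarrow> 'a::{banach, second_countable_topology}"
  shows "(LINT x|lborel. f (t + x)) = (LINT x|lborel. f x)"
  using lborel_integral_real_affine[of 1 f t] by simp

lemma integrable_translate:
  fixes f :: "real \<Rightarrow> 'a::{banach, second_countable_topology}"
  assumes "integrable lborel f"
  shows "integrable lborel (\<lambda>x. f (t + x))"
  using lborel_integrable_real_affine[OF assms, of 1 t] by simp

text \<open>The reproducing formula for the translate by \<open>t\<close> bounds \<open>g t\<close>
  through the integral of |g|^2, which translation does not change, so the bound is independent of
  \<open>t\<close>.\<close>

lemma PW2_bounded_on_reals:
  assumes g: "g \<in> PW2"
  obtains B where "\<And>x::real. cmod (g (of_real x)) \<le> B"
proof -
  define N where "N = (LINT x|lborel. (cmod (g (of_real x)))\<^sup>2)"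
  define P where "P = (LINT x|lborel. (1 + pi\<^sup>2) * (1 / (1 + x\<^sup>2)))"
  have "cmod (g (of_real t)) \<le> (N + P) / 2 / pi" for t
  proof -
    define h where "h = (\<lambda>z. g (of_real t + z))"
    have h: "h \<in> PW2" unfolding h_def by (rule PW2_translate[OF g])
    have Ih: "integrable lborel (\<lambda>x. (cmod (h (of_real x)))\<^sup>2)" by (rule PW2_D(3)[OF h])
    have IP: "integrable lborel (\<lambda>x. (1 + pi\<^sup>2) * (1 / (1 + x\<^sup>2)))"
      by (intro integrable_mult_right integrable_inverse_1_plus_square)
    have "pi * cmod (h 0) = cmod (LINT x|lborel. h (of_real x) * of_real (sin (pi * x) / x))"
      unfolding PW2_reproducing(2)[OF h] by (simp add: norm_mult)
    also have "\<dots> \<le> (LINT x|lborel. ((cmod (h (of_real x)))\<^sup>2 + (1 + pi\<^sup>2) * (1 / (1 + x\<^sup>2))) / 2)"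
    proof (rule Bochner_Integration.integral_norm_bound_integral)
      show "integrable lborel (\<lambda>x. h (of_real x) * of_real (sin (pi * x) / x))"
        by (rule PW2_reproducing(1)[OF h])
      show "integrable lborel (\<lambda>x. ((cmod (h (of_real x)))\<^sup>2 + (1 + pi\<^sup>2) * (1 / (1 + x\<^sup>2))) / 2)"
        by (intro integrable_divide Bochner_Integration.integrable_add Ih IP)
      fix x :: real
      have "norm (h (of_real x) * of_real (sin (pi * x) / x)) = cmod (h (of_real x)) * \<bar>sin (pi * x) / x\<bar>"
        by (simp only: norm_mult norm_of_real)
      also have "\<dots> \<le> ((cmod (h (of_real x)))\<^sup>2 + (sin (pi * x) / x)\<^sup>2) / 2"
        using mult_le_half_sum_squares[of "cmod (h (of_real x))" "\<bar>sin (pi * x) / x\<bar>"]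
        by (simp only: power2_abs)
      also have "\<dots> \<le> ((cmod (h (of_real x)))\<^sup>2 + (1 + pi\<^sup>2) * (1 / (1 + x\<^sup>2))) / 2"
        using sin_over_square_le[of pi x] by (intro divide_right_mono add_left_mono) simp_all
      finally show "norm (h (of_real x) * of_real (sin (pi * x) / x)) \<le> \<dots>" .
    qed
    also have "\<dots> = ((LINT x|lborel. (cmod (h (of_real x)))\<^sup>2) + P) / 2"
      unfolding integral_divide_zero P_def by (subst Bochner_Integration.integral_add[OF Ih IP]) simp
    also have "(LINT x|lborel. (cmod (h (of_real x)))\<^sup>2) = N"
      using lborel_integral_translate[of "\<lambda>x. (cmod (g (of_real x)))\<^sup>2" t] by (simp add: h_def N_def)
    finally show ?thesis by (simp add: h_def field_simps)
  qed
  then show ?thesis using that by blast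
qed

text \<open>Young's inequality for an L^2 function and an L^1 weight: Jensen bounds
  \<open>(F x)^2\<close> by the total mass of \<open>w\<close> times the average of
  \<open>h^2\<close>, and Tonelli with translation invariance integrates that over \<open>x\<close>.
  The bound \<open>w t \<le> 1\<close> gives integrability of \<open>h^2 w\<close> at every
  \<open>x\<close>.\<close>

lemma integrable_square_of_weighted_average:
  fixes h w F :: "real \<Rightarrow> real"
  assumes h: "integrable lborel (\<lambda>x. (h x)\<^sup>2)" and [measurable]: "h \<in> borel_measurable borel"
    and w: "integrable lborel w" "\<And>t. 0 < w t" "\<And>t. w t \<le> 1"
    and [measurable]: "F \<in> borel_measurable borel"
    and F: "\<And>x. \<bar>F x\<bar> \<le> (LINT t|lborel. h (x + t) * w t)"
  shows "integrable lborel (\<lambda>x. (F x)\<^sup>2)"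
proof -
  have [measurable]: "w \<in> borel_measurable borel" using borel_measurable_integrable[OF w(1)] by simp
  define S where "S = (LINT t|lborel. w t)"
  have S0: "S \<ge> 0" unfolding S_def using w(2) by (intro Bochner_Integration.integral_nonneg) (auto intro: less_imp_le)
  have hx: "integrable lborel (\<lambda>t. (h (x + t))\<^sup>2)" for x by (rule integrable_translate[OF h])
  have h2w: "integrable lborel (\<lambda>t. (h (x + t))\<^sup>2 * w t)" for x
  proof (rule Bochner_Integration.integrable_bound[OF hx[of x]])
    show "AE t in lborel. norm ((h (x + t))\<^sup>2 * w t) \<le> norm ((h (x + t))\<^sup>2)"
      using w(2,3) by (auto simp: abs_mult less_imp_le intro!: mult_left_le)
  qed measurable
  have hw: "integrable lborel (\<lambda>t. h (x + t) * w t)" for x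
  proof (rule Bochner_Integration.integrable_bound[OF Bochner_Integration.integrable_add[OF h2w[of x] w(1)]])
    show "AE t in lborel. norm (h (x + t) * w t) \<le> norm ((h (x + t))\<^sup>2 * w t + w t)"
    proof (rule AE_I2)
      fix t
      have "\<bar>h (x + t)\<bar> \<le> (h (x + t))\<^sup>2 + 1"
        using mult_le_half_sum_squares[of "\<bar>h (x + t)\<bar>" 1] zero_le_power2[of "h (x + t)"] by simp
      then have "\<bar>h (x + t)\<bar> * w t \<le> ((h (x + t))\<^sup>2 + 1) * w t"
        using w(2)[of t] by (intro mult_right_mono) auto
      then show "norm (h (x + t) * w t) \<le> norm ((h (x + t))\<^sup>2 * w t + w t)"
        using w(2)[of t] by (simp add: abs_mult distrib_right)
    qed
  qed measurable
  \<comment> \<open>Jensen's inequality for the weight \<open>w\<close>, from \<open>(S h - A)\<^sup>2 \<ge> 0\<close>.\<close>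
  have le: "(F x)\<^sup>2 \<le> S * (LINT t|lborel. (h (x + t))\<^sup>2 * w t)" for x
  proof -
    define A where "A = (LINT t|lborel. h (x + t) * w t)"
    define B where "B = (LINT t|lborel. (h (x + t))\<^sup>2 * w t)"
    have "0 \<le> (LINT t|lborel. S\<^sup>2 * ((h (x + t))\<^sup>2 * w t) - 2 * S * A * (h (x + t) * w t) + A\<^sup>2 * w t)"
    proof (rule Bochner_Integration.integral_nonneg)
      fix t
      have "S\<^sup>2 * ((h (x + t))\<^sup>2 * w t) - 2 * S * A * (h (x + t) * w t) + A\<^sup>2 * w t = (S * h (x + t) - A)\<^sup>2 * w t"
        by (simp add: power2_eq_square algebra_simps)
      then show "0 \<le> S\<^sup>2 * ((h (x + t))\<^sup>2 * w t) - 2 * S * A * (h (x + t) * w t) + A\<^sup>2 * w t"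
        using w(2)[of t] by simp
    qed
    also have "\<dots> = S\<^sup>2 * B - 2 * S * A * A + A\<^sup>2 * S"
      unfolding A_def B_def S_def
      by (subst Bochner_Integration.integral_add Bochner_Integration.integral_diff integral_mult_right_zero;
          (intro Bochner_Integration.integrable_diff integrable_mult_right h2w hw w)?)+ simp
    finally have "S * A\<^sup>2 \<le> S * (S * B)" by (simp add: power2_eq_square algebra_simps)
    moreover have "S \<noteq> 0"
    proof
      assume "S = 0"
      then have "AE t in lborel. w t = 0"
        unfolding S_def using w by (subst (asm) integral_nonneg_eq_0_iff_AE) (auto intro: less_imp_le)
      then have "AE t in (lborel::real measure). False" by eventually_elim (use w(2) in \<open>metis less_irrefl\<close>)
      then show False using AE_iff_measurable[of "UNIV" lborel "\<lambda>t::real. False"] by simp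
    qed
    ultimately have "A\<^sup>2 \<le> S * B" using S0 by simp
    moreover have "(F x)\<^sup>2 \<le> A\<^sup>2" using F[of x] unfolding A_def
      by (metis abs_ge_zero abs_le_square_iff abs_of_nonneg order_trans)
    ultimately show ?thesis unfolding B_def by simp
  qed
  have "(\<integral>\<^sup>+x. ennreal ((F x)\<^sup>2) \<partial>lborel) \<le> (\<integral>\<^sup>+x. ennreal S * (\<integral>\<^sup>+t. ennreal ((h (x + t))\<^sup>2 * w t) \<partial>lborel) \<partial>lborel)"
  proof (rule nn_integral_mono)
    fix x
    have "ennreal ((F x)\<^sup>2) \<le> ennreal (S * (LINT t|lborel. (h (x + t))\<^sup>2 * w t))" by (intro ennreal_leI le)
    also have "\<dots> = ennreal S * (\<integral>\<^sup>+t. ennreal ((h (x + t))\<^sup>2 * w t) \<partial>lborel)"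
      using S0 by (subst nn_integral_eq_integral[OF h2w]) (auto simp: ennreal_mult' less_imp_le[OF w(2)])
    finally show "ennreal ((F x)\<^sup>2) \<le> \<dots>" .
  qed
  also have "\<dots> = ennreal S * (\<integral>\<^sup>+x. (\<integral>\<^sup>+t. ennreal ((h (x + t))\<^sup>2 * w t) \<partial>lborel) \<partial>lborel)"
    by (rule nn_integral_cmult) measurable
  also have "(\<integral>\<^sup>+x. (\<integral>\<^sup>+t. ennreal ((h (x + t))\<^sup>2 * w t) \<partial>lborel) \<partial>lborel)
      = (\<integral>\<^sup>+t. (\<integral>\<^sup>+x. ennreal ((h (x + t))\<^sup>2 * w t) \<partial>lborel) \<partial>lborel)"
    by (rule lborel_pair.Fubini') measurable
  also have "\<dots> = (\<integral>\<^sup>+t. ennreal (LINT x|lborel. (h x)\<^sup>2) * ennreal (w t) \<partial>lborel)"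
  proof (rule nn_integral_cong)
    fix t
    have "(\<integral>\<^sup>+x. ennreal ((h (x + t))\<^sup>2 * w t) \<partial>lborel) = ennreal (LINT x|lborel. (h (x + t))\<^sup>2 * w t)"
      using hx[of t] w(2)[of t] by (intro nn_integral_eq_integral) (auto simp: add.commute)
    also have "(LINT x|lborel. (h (x + t))\<^sup>2 * w t) = (LINT x|lborel. (h x)\<^sup>2) * w t"
      using lborel_integral_translate[of "\<lambda>x. (h x)\<^sup>2" t] by (simp add: add.commute)
    finally show "(\<integral>\<^sup>+x. ennreal ((h (x + t))\<^sup>2 * w t) \<partial>lborel) = ennreal (LINT x|lborel. (h x)\<^sup>2) * ennreal (w t)"
      using w(2)[of t] by (simp add: ennreal_mult)
  qed
  also have "\<dots> = ennreal (LINT x|lborel. (h x)\<^sup>2) * ennreal S"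
    unfolding S_def using w by (subst nn_integral_cmult) (auto simp: nn_integral_eq_integral less_imp_le)
  finally have "(\<integral>\<^sup>+x. ennreal ((F x)\<^sup>2) \<partial>lborel) < \<infinity>"
    by (rule order_le_less_trans) (simp add: ennreal_mult_less_top)
  then show ?thesis by (intro integrableI_bounded) auto
qed

text \<open>Applied to translates, the formula for pi g'(0) becomes pi g'(x) = integral of g(x + t)
  k(t) dt. As \<open>k\<close> is dominated by an integrable weight,
  \<open>integrable_square_of_weighted_average\<close> applies.\<close>

lemma PW2_deriv_square_integrable:
  assumes g: "g \<in> PW2"
  shows "integrable lborel (\<lambda>x::real. (cmod (deriv g (of_real x)))\<^sup>2)"
proof -
  \<comment> \<open>In the combination \<open>2 sin (4 t) - sin (8 t)\<close> the terms with \<open>W 0\<close> of the limit formula for \<open>\<tau> = 4\<close>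
    and \<open>\<tau> = 8\<close> cancel, and the resulting kernel \<open>k\<close> for \<open>\<pi> g'(0)\<close> is absolutely integrable.\<close>
  define w where "w = (\<lambda>t::real. 1 / (1 + t\<^sup>2))"
  define k where "k = (\<lambda>t::real. csinc (1/4) (of_real t) * of_real ((2 * sin (4 * t) - sin (8 * t)) / t\<^sup>2))"
  have k: "cmod (k t) \<le> 100 * w t" for t
  proof (cases "t = 0")
    case False
    \<comment> \<open>The factorisation shows a zero of order 3 at \<open>t = 0\<close>; order 2 is
      enough to offset the division by t^2. The bounds 4 and 32 t^2 combine to 36 t^2, and 100 is a
      generous round constant.\<close>
    have u: "2 * sin (4 * t) - sin (8 * t) = 2 * sin (4 * t) * (1 - cos (4 * t))"
      using sin_double[of "4 * t"] by (simp add: algebra_simps)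
    have c1: "\<bar>1 - cos (4 * t)\<bar> \<le> 2" using cos_ge_minus_one[of "4 * t"] by (simp add: abs_le_iff)
    have c2: "\<bar>1 - cos (4 * t)\<bar> \<le> \<bar>4 * t\<bar>"
    proof -
      have "1 - cos (4 * t) = 2 * (sin (2 * t))\<^sup>2" using cos_double_sin[of "2 * t"] by simp
      also have "\<dots> = 2 * (\<bar>sin (2 * t)\<bar> * \<bar>sin (2 * t)\<bar>)" by (simp add: power2_eq_square)
      also have "\<dots> \<le> 2 * (\<bar>2 * t\<bar> * 1)"
        by (intro mult_left_mono mult_mono abs_sin_x_le_abs_x) auto
      finally show ?thesis by simp
    qed
    have 1: "\<bar>2 * sin (4 * t) - sin (8 * t)\<bar> \<le> 4"
      unfolding u abs_mult using mult_mono[OF abs_sin_le_one c1, of "4 * t"] by simp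
    have 2: "\<bar>2 * sin (4 * t) - sin (8 * t)\<bar> \<le> 32 * t\<^sup>2"
      unfolding u abs_mult using mult_mono[OF abs_sin_x_le_abs_x c2, of "4 * t"]
      by (simp add: power2_eq_square abs_mult)
    have "\<bar>2 * sin (4 * t) - sin (8 * t)\<bar> * (1 + t\<^sup>2) \<le> 32 * t\<^sup>2 + 4 * t\<^sup>2"
      unfolding distrib_left using 2 mult_right_mono[OF 1, of "t\<^sup>2"] by simp
    also have "\<dots> \<le> 100 * t\<^sup>2" by simp
    finally have 3: "\<bar>2 * sin (4 * t) - sin (8 * t)\<bar> / t\<^sup>2 \<le> 100 / (1 + t\<^sup>2)"
      using False by (simp add: divide_le_eq pos_le_divide_eq add_pos_nonneg mult.commute)
    have "cmod (k t) \<le> 1 * (\<bar>2 * sin (4 * t) - sin (8 * t)\<bar> / t\<^sup>2)"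
      unfolding k_def norm_mult norm_of_real abs_divide by (intro mult_mono cmod_csinc_real_le) auto
    with 3 show ?thesis by (simp add: w_def)
  qed (simp add: k_def w_def)
  have w: "integrable lborel w" "\<And>t. 0 < w t" "\<And>t. w t \<le> 1"
    unfolding w_def by (rule integrable_inverse_1_plus_square) (auto simp: add_pos_nonneg divide_le_eq_1)
  have [measurable]: "k \<in> borel_measurable borel"
  proof -
    have [measurable]: "(\<lambda>t. csinc (1/4) (of_real t)) \<in> borel_measurable borel"
      by (intro entire_borel_measurable_of_real holomorphic_csinc) simp
    show ?thesis unfolding k_def by measurable
  qed
  have [measurable]: "w \<in> borel_measurable borel" using borel_measurable_integrable[OF w(1)] by simp
  have value_0: "integrable lborel (\<lambda>t. f (of_real t) * k t)" "(LINT t|lborel. f (of_real t) * k t) = of_real pi * deriv f 0"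
    if f: "f \<in> PW2" for f
  proof -
    note [measurable] = PW2_D(6)[OF f]
    show int: "integrable lborel (\<lambda>t. f (of_real t) * k t)"
    proof (rule Bochner_Integration.integrable_bound)
      show "integrable lborel (\<lambda>t. (cmod (f (of_real t)))\<^sup>2 + 10000 * w t)"
        by (intro Bochner_Integration.integrable_add PW2_D(3)[OF f] integrable_mult_right w)
      show "AE t in lborel. norm (f (of_real t) * k t) \<le> norm ((cmod (f (of_real t)))\<^sup>2 + 10000 * w t)"
      proof (rule AE_I2)
        fix t
        have "(cmod (k t))\<^sup>2 \<le> (100 * w t)\<^sup>2" using k[of t] by (intro power_mono) auto
        also have "\<dots> \<le> 10000 * w t"
          using w(2,3)[of t] by (simp add: power_mult_distrib power2_eq_square mult_left_le)
        finally have "norm (f (of_real t) * k t) \<le> (cmod (f (of_real t)))\<^sup>2 + 10000 * w t"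
          unfolding norm_mult by (rule mult_le_square_plus)
        then show "norm (f (of_real t) * k t) \<le> norm ((cmod (f (of_real t)))\<^sup>2 + 10000 * w t)" by simp
      qed
    qed measurable
    define W where "W = (\<lambda>z. f z * csinc (1/4) z)"
    have holW: "W holomorphic_on UNIV" unfolding W_def
      by (intro holomorphic_intros PW2_D(1)[OF f] holomorphic_csinc) simp
    \<comment> \<open>The type 4 is admissible because pi + 1/4 < 4. The same \<open>M\<close>
      serves for type 8, so one \<open>W\<close> can be used in both limit formulas.\<close>
    obtain M where M: "\<And>z. cmod (W z) \<le> M * exp (4 * \<bar>Im z\<bar>)"
      unfolding W_def using PW2_times_csinc_bound[OF f, of "1/4" 4] pi_less_4
        pi_approx by auto
    have M0: "M \<ge> 0" using order_trans[OF norm_ge_zero M[of 0]] by simp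
    have M8: "cmod (W z) \<le> M * exp (8 * \<bar>Im z\<bar>)" for z
      by (rule order_trans[OF M]) (use M0 in \<open>auto intro: mult_left_mono\<close>)
    have dW: "deriv W 0 = deriv f 0"
      unfolding W_def using DERIV_mult[OF PW2_D(5)[OF f, of 0] deriv_csinc_0[of "1/4"]]
      by (intro DERIV_imp_deriv) simp
    note L4 = riesz_integral_limit[OF holW M]
    note L8 = riesz_integral_limit[OF holW M8]
    let ?Q = "\<lambda>\<tau> x::real. (W (of_real x) * of_real (sin (\<tau> * x)) - of_real \<tau> * W 0 * of_real x) / (of_real x)\<^sup>2"
    have Q: "2 * ?Q 4 x - ?Q 8 x = f (of_real x) * k x" for x
    proof -
      have "2 * ?Q 4 x - ?Q 8 x = (W (of_real x) * (2 * of_real (sin (4 * x)) - of_real (sin (8 * x)))) / (of_real x)\<^sup>2"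
        by (simp only: times_divide_eq_right diff_divide_distrib[symmetric]) (simp add: algebra_simps)
      then show ?thesis by (simp add: W_def k_def)
    qed
    have "integral {-real n..real n} (\<lambda>x. f (of_real x) * k x) = 2 * integral {-real n..real n} (?Q 4) - integral {-real n..real n} (?Q 8)" for n
      unfolding Q[symmetric]
      by (subst Henstock_Kurzweil_Integration.integral_diff[OF integrable_on_mult_right[OF L4(1)] L8(1)])
         (simp only: integral_mult_right)
    moreover have "(\<lambda>n. 2 * integral {-real n..real n} (?Q 4) - integral {-real n..real n} (?Q 8)) \<longlonglongrightarrow>
        2 * (of_real pi * deriv W 0) - of_real pi * deriv W 0"
      by (intro tendsto_intros L4(2) L8(2))
    ultimately have "(\<lambda>n. integral {-real n..real n} (\<lambda>x. f (of_real x) * k x)) \<longlonglongrightarrow> of_real pi * deriv f 0"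
      by (simp add: dW)
    with integral_symmetric_limit[OF int]
    show "(LINT t|lborel. f (of_real t) * k t) = of_real pi * deriv f 0" by (rule LIMSEQ_unique)
  qed
  have "integrable lborel (\<lambda>x. (pi * cmod (deriv g (of_real x)) / 100)\<^sup>2)"
  proof (rule integrable_square_of_weighted_average[where h="\<lambda>x. cmod (g (of_real x))" and w=w])
    note [measurable] = PW2_D(6)[OF g]
    show "integrable lborel (\<lambda>x. (cmod (g (of_real x)))\<^sup>2)" by (rule PW2_D(3)[OF g])
    show "(\<lambda>x. cmod (g (of_real x))) \<in> borel_measurable borel" by measurable
    have [measurable]: "(\<lambda>x. deriv g (of_real x)) \<in> borel_measurable borel"
      by (intro entire_borel_measurable_of_real holomorphic_deriv PW2_D(1)[OF g] open_UNIV)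
    show "(\<lambda>x. pi * cmod (deriv g (of_real x)) / 100) \<in> borel_measurable borel" by measurable
    fix x :: real
    define f where "f = (\<lambda>z. g (of_real x + z))"
    have f: "f \<in> PW2" unfolding f_def by (rule PW2_translate[OF g])
    note [measurable] = PW2_D(6)[OF f]
    have "deriv f 0 = deriv g (of_real x)"
      unfolding f_def using PW2_D(5)[OF g, of "of_real x"] DERIV_shift[of g _ 0 "of_real x"]
      by (intro DERIV_imp_deriv) (simp add: add.commute)
    then have "pi * cmod (deriv g (of_real x)) = cmod (LINT t|lborel. f (of_real t) * k t)"
      unfolding value_0(2)[OF f] by (simp add: norm_mult)
    also have "\<dots> \<le> (LINT t|lborel. 100 * (cmod (g (of_real (x + t))) * w t))"
    proof (rule Bochner_Integration.integral_norm_bound_integral[OF value_0(1)[OF f]])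
      show "integrable lborel (\<lambda>t. 100 * (cmod (g (of_real (x + t))) * w t))"
      proof (intro integrable_mult_right, rule Bochner_Integration.integrable_bound)
        show "integrable lborel (\<lambda>t. (cmod (f (of_real t)))\<^sup>2 + w t)"
          by (intro Bochner_Integration.integrable_add PW2_D(3)[OF f] w)
        show "AE t in lborel. norm (cmod (g (of_real (x + t))) * w t) \<le> norm ((cmod (f (of_real t)))\<^sup>2 + w t)"
        proof (rule AE_I2)
          fix t
          have "(w t)\<^sup>2 \<le> w t" using w(2,3)[of t] by (simp add: power2_eq_square mult_left_le)
          then have "cmod (f (of_real t)) * w t \<le> (cmod (f (of_real t)))\<^sup>2 + w t"
            by (rule mult_le_square_plus)
          then show "norm (cmod (g (of_real (x + t))) * w t) \<le> norm ((cmod (f (of_real t)))\<^sup>2 + w t)"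
            using w(2)[of t] by (simp add: f_def abs_mult)
        qed
      qed measurable
      fix t
      show "norm (f (of_real t) * k t) \<le> 100 * (cmod (g (of_real (x + t))) * w t)"
        using mult_left_mono[OF k[of t], of "cmod (f (of_real t))"] by (simp add: norm_mult f_def mult_ac)
    qed
    finally show "\<bar>pi * cmod (deriv g (of_real x)) / 100\<bar> \<le> (LINT t|lborel. cmod (g (of_real (x + t))) * w t)"
      by (simp add: abs_mult)
  qed (use w in auto)
  from integrable_mult_right[OF this, of "(100 / pi)\<^sup>2"]
  show ?thesis by (simp add: power_mult_distrib power_divide)
qed

subsection \<open>The kernel representing evaluation at the origin\<close>

text \<open>Differentiation in \<open>z\<close> exchanges this transform with
  \<open>sin_transform\<close> and multiplies the density by \<open>t\<close>, up to the factor
  \<plusminus> pi. So the kernel and its first two derivatives are all transforms of explicit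
  densities.\<close>

definition cos_transform :: "(real \<Rightarrow> real) \<Rightarrow> complex \<Rightarrow> complex" where
  "cos_transform q z = integral {0..1} (\<lambda>t. of_real (q t) * cos (of_real pi * z * of_real t))"

definition sin_transform :: "(real \<Rightarrow> real) \<Rightarrow> complex \<Rightarrow> complex" where
  "sin_transform q z = integral {0..1} (\<lambda>t. of_real (q t) * sin (of_real pi * z * of_real t))"

lemma continuous_on_of_real_snd:
  fixes q :: "real \<Rightarrow> real"
  assumes "continuous_on S q"
  shows "continuous_on (UNIV \<times> S) (\<lambda>x. of_real (q (snd x)) :: complex)"
  by (intro continuous_on_of_real continuous_on_compose2[OF assms] continuous_intros) auto

lemma DERIV_cos_transform:
  assumes q: "continuous_on {0..1} q"
  shows "(cos_transform q has_field_derivative - of_real pi * sin_transform (\<lambda>t. t * q t) z) (at z)"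
proof -
  have "((\<lambda>z. integral (cbox 0 1) (\<lambda>t. of_real (q t) * cos (of_real pi * z * of_real t))) has_field_derivative
     integral (cbox 0 1) (\<lambda>t. - of_real pi * (of_real (t * q t) * sin (of_real pi * z * of_real t)))) (at z within UNIV)"
  proof (rule leibniz_rule_field_derivative)
    show "((\<lambda>z. of_real (q t) * cos (of_real pi * z * of_real t)) has_field_derivative
       - of_real pi * (of_real (t * q t) * sin (of_real pi * z * of_real t))) (at z within UNIV)" for z :: complex and t
      by (auto intro!: derivative_eq_intros)
    show "(\<lambda>t. of_real (q t) * cos (of_real pi * z * of_real t)) integrable_on cbox 0 1" for z :: complex
      using q by (intro integrable_continuous) (auto intro!: continuous_intros)
    show "continuous_on (UNIV \<times> cbox 0 1) (\<lambda>(z::complex, t). - of_real pi * (of_real (t * q t) * sin (of_real pi * z * of_real t)))"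
      unfolding case_prod_beta using continuous_on_of_real_snd[OF q]
      by (auto intro!: continuous_intros)
  qed auto
  then show ?thesis by (simp add: cos_transform_def[abs_def] sin_transform_def)
qed

lemma DERIV_sin_transform:
  assumes q: "continuous_on {0..1} q"
  shows "(sin_transform q has_field_derivative of_real pi * cos_transform (\<lambda>t. t * q t) z) (at z)"
proof -
  have "((\<lambda>z. integral (cbox 0 1) (\<lambda>t. of_real (q t) * sin (of_real pi * z * of_real t))) has_field_derivative
     integral (cbox 0 1) (\<lambda>t. of_real pi * (of_real (t * q t) * cos (of_real pi * z * of_real t)))) (at z within UNIV)"
  proof (rule leibniz_rule_field_derivative)
    show "((\<lambda>z. of_real (q t) * sin (of_real pi * z * of_real t)) has_field_derivative
       of_real pi * (of_real (t * q t) * cos (of_real pi * z * of_real t))) (at z within UNIV)" for z :: complex and t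
      by (auto intro!: derivative_eq_intros)
    show "(\<lambda>t. of_real (q t) * sin (of_real pi * z * of_real t)) integrable_on cbox 0 1" for z :: complex
      using q by (intro integrable_continuous) (auto intro!: continuous_intros)
    show "continuous_on (UNIV \<times> cbox 0 1) (\<lambda>(z::complex, t). of_real pi * (of_real (t * q t) * cos (of_real pi * z * of_real t)))"
      unfolding case_prod_beta using continuous_on_of_real_snd[OF q]
      by (auto intro!: continuous_intros)
  qed auto
  then show ?thesis by (simp add: sin_transform_def[abs_def] cos_transform_def)
qed

lemma cos_transform_of_real:
  assumes "continuous_on {0..1} q"
  shows "cos_transform q (of_real x) = of_real (integral {0..1} (\<lambda>t. q t * cos (pi * x * t)))"
proof -
  have "(\<lambda>t. q t * cos (pi * x * t)) integrable_on {0..1}"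
    using assms by (intro integrable_continuous_real continuous_intros)
  from integral_unique[OF has_integral_of_real[OF integrable_integral[OF this], where 'b=complex]]
  show ?thesis by (simp add: cos_transform_def flip: cos_of_real)
qed

lemma sin_transform_of_real:
  assumes "continuous_on {0..1} q"
  shows "sin_transform q (of_real x) = of_real (integral {0..1} (\<lambda>t. q t * sin (pi * x * t)))"
proof -
  have "(\<lambda>t. q t * sin (pi * x * t)) integrable_on {0..1}"
    using assms by (intro integrable_continuous_real continuous_intros)
  from integral_unique[OF has_integral_of_real[OF integrable_integral[OF this], where 'b=complex]]
  show ?thesis by (simp add: sin_transform_def flip: sin_of_real)
qed

text \<open>Here \<open>p'\<close> oscillates and \<open>p\<close> is a small antiderivative of it;
  moving the derivative to \<open>q\<close> leaves endpoint terms and an integral, each of the order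
  of \<open>m\<close>.\<close>

lemma integral_by_parts_bound:
  fixes q q' p p' :: "real \<Rightarrow> real"
  assumes q: "\<And>t. t \<in> {0..1} \<Longrightarrow> (q has_real_derivative q' t) (at t)" "continuous_on {0..1} q'"
    and p: "\<And>t. (p has_real_derivative p' t) (at t)" "continuous_on {0..1} p'"
    and m: "\<And>t. \<bar>p t\<bar> \<le> m" and B: "\<And>t. t \<in> {0..1} \<Longrightarrow> \<bar>q' t\<bar> \<le> B"
  shows "\<bar>integral {0..1} (\<lambda>t. q t * p' t)\<bar> \<le> (\<bar>q 0\<bar> + \<bar>q 1\<bar> + B) * m"
proof -
  have contp: "continuous_on {0..1} p" using p(1) by (meson DERIV_isCont continuous_at_imp_continuous_on)
  have contq: "continuous_on {0..1} q" using q(1) by (meson DERIV_isCont continuous_at_imp_continuous_on)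
  have m0: "m \<ge> 0" using m[of 0] by linarith
  have "((\<lambda>t. q' t * p t + q t * p' t) has_integral (q 1 * p 1 - q 0 * p 0)) {0..1}"
  proof (rule fundamental_theorem_of_calculus)
    show "((\<lambda>t. q t * p t) has_vector_derivative q' t * p t + q t * p' t) (at t within {0..1})" if "t \<in> {0..1}" for t
      unfolding has_real_derivative_iff_has_vector_derivative[symmetric]
      using has_field_derivative_at_within[OF DERIV_mult[OF q(1)[OF that] p(1)[of t]]] by (simp add: mult.commute)
  qed auto
  moreover have i1: "(\<lambda>t. q' t * p t) integrable_on {0..1}" "(\<lambda>t. q t * p' t) integrable_on {0..1}"
    by (intro integrable_continuous_real continuous_intros contp contq q p)+
  ultimately have eq: "integral {0..1} (\<lambda>t. q t * p' t) = q 1 * p 1 - q 0 * p 0 - integral {0..1} (\<lambda>t. q' t * p t)"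
    using Henstock_Kurzweil_Integration.integral_add[OF i1] by (simp add: integral_unique)
  have "norm (integral {0..1} (\<lambda>t. q' t * p t)) \<le> B * m * (1 - 0)"
    using m B m0 by (intro integral_bound continuous_intros contp q) (auto simp: abs_mult intro!: mult_mono order_trans[OF abs_ge_zero B])
  moreover have "\<bar>q 1 * p 1\<bar> \<le> \<bar>q 1\<bar> * m" "\<bar>q 0 * p 0\<bar> \<le> \<bar>q 0\<bar> * m"
    using m by (auto simp: abs_mult intro: mult_left_mono)
  ultimately show ?thesis unfolding eq by (simp add: algebra_simps)
qed

lemma continuous_on_Icc_bounded:
  fixes f :: "real \<Rightarrow> real"
  assumes "continuous_on {u..v} f"
  obtains B where "\<And>x. x \<in> {u..v} \<Longrightarrow> \<bar>f x\<bar> \<le> B"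
proof -
  obtain B where "\<forall>y\<in>f ` {u..v}. norm y \<le> B"
    using compact_imp_bounded[OF compact_continuous_image[OF assms compact_Icc]] by (auto simp: bounded_iff)
  then show ?thesis using that[of B] by simp
qed

text \<open>The antiderivatives of cos(pi x t) and sin(pi x t) in \<open>t\<close> are of size 1 /
  |pi x|. First-order decay is all that square integrability and the boundary terms will
  require.\<close>

lemma oscillatory_integral_decay:
  fixes q q' :: "real \<Rightarrow> real"
  assumes q: "\<And>t. t \<in> {0..1} \<Longrightarrow> (q has_real_derivative q' t) (at t)" "continuous_on {0..1} q'"
  obtains D where "\<And>x. x \<noteq> 0 \<Longrightarrow> \<bar>integral {0..1} (\<lambda>t. q t * cos (pi * x * t))\<bar> \<le> D / \<bar>x\<bar>"
    "\<And>x. x \<noteq> 0 \<Longrightarrow> \<bar>integral {0..1} (\<lambda>t. q t * sin (pi * x * t))\<bar> \<le> D / \<bar>x\<bar>"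
proof -
  obtain B where B: "\<And>t. t \<in> {0..1} \<Longrightarrow> \<bar>q' t\<bar> \<le> B"
    using continuous_on_Icc_bounded[OF q(2)] by blast
  have "\<bar>integral {0..1} (\<lambda>t. q t * cos (pi * x * t))\<bar> \<le> (\<bar>q 0\<bar> + \<bar>q 1\<bar> + B) * (1 / \<bar>pi * x\<bar>)" if "x \<noteq> 0" for x
  proof (rule integral_by_parts_bound[OF q _ _ _ B, where p="\<lambda>t. sin (pi * x * t) / (pi * x)"])
    show "((\<lambda>t. sin (pi * x * t) / (pi * x)) has_real_derivative cos (pi * x * t)) (at t)" for t
      using that by (auto intro!: derivative_eq_intros)
    show "\<bar>sin (pi * x * t) / (pi * x)\<bar> \<le> 1 / \<bar>pi * x\<bar>" for t
      unfolding abs_divide by (intro divide_right_mono) auto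
  qed (auto intro!: continuous_intros)
  moreover have "\<bar>integral {0..1} (\<lambda>t. q t * sin (pi * x * t))\<bar> \<le> (\<bar>q 0\<bar> + \<bar>q 1\<bar> + B) * (1 / \<bar>pi * x\<bar>)" if "x \<noteq> 0" for x
  proof (rule integral_by_parts_bound[OF q _ _ _ B, where p="\<lambda>t. - cos (pi * x * t) / (pi * x)"])
    show "((\<lambda>t. - cos (pi * x * t) / (pi * x)) has_real_derivative sin (pi * x * t)) (at t)" for t
      using that by (auto intro!: derivative_eq_intros)
    show "\<bar>- cos (pi * x * t) / (pi * x)\<bar> \<le> 1 / \<bar>pi * x\<bar>" for t
      unfolding abs_divide by (intro divide_right_mono) auto
  qed (auto intro!: continuous_intros)
  ultimately show ?thesis
    using that[of "(\<bar>q 0\<bar> + \<bar>q 1\<bar> + B) / pi"] by (simp add: abs_mult)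
qed

lemma square_integrable_of_decay:
  fixes f :: "real \<Rightarrow> real"
  assumes cont: "continuous_on UNIV f" and decay: "\<And>x. x \<noteq> 0 \<Longrightarrow> \<bar>f x\<bar> \<le> D / \<bar>x\<bar>"
  shows "integrable lborel (\<lambda>x. (f x)\<^sup>2)"
proof -
  obtain B where B: "\<And>x. x \<in> {-1..1} \<Longrightarrow> \<bar>f x\<bar> \<le> B"
    using continuous_on_Icc_bounded[OF continuous_on_subset[OF cont]] by blast
  have [measurable]: "f \<in> borel_measurable borel" by (rule borel_measurable_continuous_onI[OF cont])
  have "(f x)\<^sup>2 \<le> 2 * (B\<^sup>2 + D\<^sup>2) * (1 / (1 + x\<^sup>2))" for x
  proof (cases "\<bar>x\<bar> \<le> 1")
    case True
    have "\<bar>f x\<bar> \<le> \<bar>B\<bar>" using B[of x] True by (auto simp: abs_le_iff)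
    then have "(f x)\<^sup>2 \<le> B\<^sup>2" by (simp add: abs_le_square_iff)
    moreover have "x\<^sup>2 \<le> 1" using True by (simp add: abs_square_le_1)
    ultimately have "(f x)\<^sup>2 * (1 + x\<^sup>2) \<le> B\<^sup>2 * 2" by (intro mult_mono) auto
    also have "\<dots> \<le> 2 * (B\<^sup>2 + D\<^sup>2)" by simp
    finally show ?thesis by (simp add: pos_le_divide_eq add_pos_nonneg)
  next
    case False
    have "\<bar>f x\<bar> \<le> D / \<bar>x\<bar>" using decay[of x] False by auto
    also have "\<dots> \<le> \<bar>D / x\<bar>" unfolding abs_divide by (intro divide_right_mono) auto
    finally have "\<bar>f x\<bar> \<le> \<bar>D / x\<bar>" .
    then have "(f x)\<^sup>2 \<le> D\<^sup>2 / x\<^sup>2" by (metis abs_le_square_iff power_divide)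
    moreover have "1 + x\<^sup>2 \<le> 2 * x\<^sup>2" using False power_mono[of 1 "\<bar>x\<bar>" 2] by simp
    ultimately have "(f x)\<^sup>2 * (1 + x\<^sup>2) \<le> D\<^sup>2 / x\<^sup>2 * (2 * x\<^sup>2)" by (intro mult_mono) auto
    also have "\<dots> = 2 * D\<^sup>2" using False by auto
    also have "\<dots> \<le> 2 * (B\<^sup>2 + D\<^sup>2)" by simp
    finally show ?thesis by (simp add: pos_le_divide_eq add_pos_nonneg)
  qed
  then have "AE x in lborel. norm ((f x)\<^sup>2) \<le> norm (2 * (B\<^sup>2 + D\<^sup>2) * (1 / (1 + x\<^sup>2)))"
    by (intro AE_I2) (smt (verit) real_norm_def zero_le_power2)
  then show ?thesis
    by (intro Bochner_Integration.integrable_bound[OF integrable_mult_right[OF integrable_inverse_1_plus_square]]) measurable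
qed

lemma integrable_product:
  fixes f h :: "real \<Rightarrow> complex"
  assumes [measurable]: "f \<in> borel_measurable borel" "h \<in> borel_measurable borel"
    and "integrable lborel (\<lambda>x. (cmod (f x))\<^sup>2)" "integrable lborel (\<lambda>x. (cmod (h x))\<^sup>2)"
  shows "integrable lborel (\<lambda>x. f x * h x)"
proof (rule Bochner_Integration.integrable_bound)
  show "integrable lborel (\<lambda>x. (cmod (f x))\<^sup>2 + (cmod (h x))\<^sup>2)"
    using assms by (intro Bochner_Integration.integrable_add)
  show "AE x in lborel. norm (f x * h x) \<le> norm ((cmod (f x))\<^sup>2 + (cmod (h x))\<^sup>2)"
  proof (rule AE_I2)
    fix x
    have "norm (f x * h x) \<le> (cmod (f x))\<^sup>2 + (cmod (h x))\<^sup>2"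
      unfolding norm_mult by (rule mult_le_square_plus) simp
    then show "norm (f x * h x) \<le> norm ((cmod (f x))\<^sup>2 + (cmod (h x))\<^sup>2)" by simp
  qed
qed measurable

section \<open>The kernel and its pairing with PW^2\<close>

definition kernel_density :: "real \<Rightarrow> real \<Rightarrow> real" where
  "kernel_density a t = 1 / (1 + a * pi\<^sup>2 * t\<^sup>2)"

definition sobolev_kernel :: "real \<Rightarrow> complex \<Rightarrow> complex" where
  "sobolev_kernel a = cos_transform (kernel_density a)"

definition sobolev_kernel' :: "real \<Rightarrow> complex \<Rightarrow> complex" where
  "sobolev_kernel' a z = - of_real pi * sin_transform (\<lambda>t. t * kernel_density a t) z"

text \<open>The nested products are left in the shape that \<open>DERIV_sin_transform\<close>
  produces.\<close>

definition sobolev_kernel'' :: "real \<Rightarrow> complex \<Rightarrow> complex" where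
  "sobolev_kernel'' a z = - of_real pi * (of_real pi * cos_transform (\<lambda>t. t * (t * kernel_density a t)) z)"

context
  fixes a :: real
  assumes a: "a > 0"
begin

lemma density_denominator: "1 + a * pi\<^sup>2 * t\<^sup>2 > 0"
  using a by (simp add: add_pos_nonneg)

lemma density_denominator_nonzero: "1 + a * pi\<^sup>2 * t\<^sup>2 \<noteq> 0"
  using density_denominator[of t] by simp

lemma DERIV_kernel_density:
  "(kernel_density a has_real_derivative - (2 * a * pi\<^sup>2 * t) / (1 + a * pi\<^sup>2 * t\<^sup>2)\<^sup>2) (at t)"
  unfolding kernel_density_def[abs_def] using density_denominator_nonzero[of t]
  by (auto intro!: derivative_eq_intros simp: power2_eq_square)

lemma continuous_kernel_density: "continuous_on S (kernel_density a)"
  using DERIV_kernel_density by (meson DERIV_isCont continuous_at_imp_continuous_on)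

lemma DERIV_kernel: "(sobolev_kernel a has_field_derivative sobolev_kernel' a z) (at z)"
  unfolding sobolev_kernel_def sobolev_kernel'_def by (rule DERIV_cos_transform[OF continuous_kernel_density])

lemma DERIV_kernel': "(sobolev_kernel' a has_field_derivative sobolev_kernel'' a z) (at z)"
  unfolding sobolev_kernel'_def[abs_def] sobolev_kernel''_def
  by (intro DERIV_cmult DERIV_sin_transform continuous_intros continuous_kernel_density)

lemma kernel_of_real: "sobolev_kernel a (of_real x) = of_real (integral {0..1} (\<lambda>t. kernel_density a t * cos (pi * x * t)))"
  unfolding sobolev_kernel_def by (rule cos_transform_of_real[OF continuous_kernel_density])

lemma sobolev_kernel'_of_real:
  "sobolev_kernel' a (of_real x) = of_real (- pi * integral {0..1} (\<lambda>t. (t * kernel_density a t) * sin (pi * x * t)))"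
  unfolding sobolev_kernel'_def by (subst sin_transform_of_real) (auto intro!: continuous_intros continuous_kernel_density)

lemma kernel_holomorphic: "sobolev_kernel a holomorphic_on UNIV" "sobolev_kernel' a holomorphic_on UNIV"
  using DERIV_kernel DERIV_kernel' by (auto simp: holomorphic_on_def field_differentiable_def)

lemma sobolev_kernel''_continuous: "continuous_on UNIV (sobolev_kernel'' a)"
  using holomorphic_on_imp_continuous_on[OF holomorphic_deriv[OF kernel_holomorphic(2) open_UNIV]]
    DERIV_imp_deriv[OF DERIV_kernel'] by (simp cong: continuous_on_cong)

text \<open>Two derivatives multiply the density by -pi^2 t^2, so \<open>k - a k''\<close> has
  density (1 + a pi^2 t^2) times \<open>kernel_density a\<close>, which is 1, and the cosine
  transform of 1 is the sinc. At \<open>x = 0\<close> the left side is 1 while the right side would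
  be 0 by division by zero.\<close>

lemma kernel_ode:
  assumes "x \<noteq> 0"
  shows "sobolev_kernel a (of_real x) - of_real a * sobolev_kernel'' a (of_real x) = of_real (sin (pi * x) / (pi * x))"
proof -
  define C where "C = (\<lambda>t. cos (pi * x * t))"
  have i: "(\<lambda>t. kernel_density a t * C t) integrable_on {0..1}" "(\<lambda>t. t * (t * kernel_density a t) * C t) integrable_on {0..1}"
    unfolding C_def by (intro integrable_continuous_real continuous_intros continuous_kernel_density)+
  have "integral {0..1} (\<lambda>t. kernel_density a t * C t) + a * pi\<^sup>2 * integral {0..1} (\<lambda>t. t * (t * kernel_density a t) * C t)
      = integral {0..1} (\<lambda>t. kernel_density a t * C t + a * pi\<^sup>2 * (t * (t * kernel_density a t) * C t))"
    using i by (subst Henstock_Kurzweil_Integration.integral_add) (auto intro: integrable_on_mult_right)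
  also have "(\<lambda>t. kernel_density a t * C t + a * pi\<^sup>2 * (t * (t * kernel_density a t) * C t)) = C"
  proof
    fix t
    have "kernel_density a t * C t + a * pi\<^sup>2 * (t * (t * kernel_density a t) * C t)
        = (1 + a * pi\<^sup>2 * t\<^sup>2) * kernel_density a t * C t" by (simp add: algebra_simps power2_eq_square)
    then show "kernel_density a t * C t + a * pi\<^sup>2 * (t * (t * kernel_density a t) * C t) = C t"
      using density_denominator_nonzero[of t] by (simp add: kernel_density_def)
  qed
  also have "integral {0..1} C = sin (pi * x) / (pi * x)"
  proof (rule integral_unique)
    have "(C has_integral (sin (pi * x * 1) / (pi * x) - sin (pi * x * 0) / (pi * x))) {0..1}"
      unfolding C_def
      by (rule fundamental_theorem_of_calculus)
         (use assms in \<open>auto intro!: derivative_eq_intros simp flip: has_real_derivative_iff_has_vector_derivative\<close>)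
    then show "(C has_integral sin (pi * x) / (pi * x)) {0..1}" by simp
  qed
  finally have eq: "integral {0..1} (\<lambda>t. kernel_density a t * C t) + a * pi\<^sup>2 * integral {0..1} (\<lambda>t. t * (t * kernel_density a t) * C t)
      = sin (pi * x) / (pi * x)" .
  have "sobolev_kernel'' a (of_real x) = of_real (- pi * (pi * integral {0..1} (\<lambda>t. t * (t * kernel_density a t) * C t)))"
    unfolding sobolev_kernel''_def C_def
    by (subst cos_transform_of_real) (auto intro!: continuous_intros continuous_kernel_density)
  then have "sobolev_kernel a (of_real x) - of_real a * sobolev_kernel'' a (of_real x) =
     of_real (integral {0..1} (\<lambda>t. kernel_density a t * C t) + a * pi\<^sup>2 * integral {0..1} (\<lambda>t. t * (t * kernel_density a t) * C t))"
    unfolding kernel_of_real C_def by (simp add: power2_eq_square algebra_simps)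
  then show ?thesis unfolding eq .
qed

lemma kernel_decay:
  obtains D where "\<And>x. x \<noteq> 0 \<Longrightarrow> cmod (sobolev_kernel a (of_real x)) \<le> D / \<bar>x\<bar>"
    "\<And>x. x \<noteq> 0 \<Longrightarrow> cmod (sobolev_kernel' a (of_real x)) \<le> D / \<bar>x\<bar>"
proof -
  let ?d = "\<lambda>t. - (2 * a * pi\<^sup>2 * t) / (1 + a * pi\<^sup>2 * t\<^sup>2)\<^sup>2"
  have cd: "continuous_on {0..1} ?d"
    using density_denominator_nonzero by (intro continuous_intros) auto
  obtain D1 where D1: "\<And>x. x \<noteq> 0 \<Longrightarrow> \<bar>integral {0..1} (\<lambda>t. kernel_density a t * cos (pi * x * t))\<bar> \<le> D1 / \<bar>x\<bar>"
    by (rule oscillatory_integral_decay[OF DERIV_kernel_density cd]) blast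
  have d2: "((\<lambda>t. t * kernel_density a t) has_real_derivative 1 * kernel_density a t + ?d t * t) (at t)" for t
    by (intro DERIV_mult DERIV_ident DERIV_kernel_density)
  have cd2: "continuous_on {0..1} (\<lambda>t. 1 * kernel_density a t + ?d t * t)"
    by (intro continuous_intros cd continuous_kernel_density)
  obtain D2 where D2: "\<And>x. x \<noteq> 0 \<Longrightarrow> \<bar>integral {0..1} (\<lambda>t. (t * kernel_density a t) * sin (pi * x * t))\<bar> \<le> D2 / \<bar>x\<bar>"
    by (rule oscillatory_integral_decay[OF d2 cd2]) blast
  show ?thesis
  proof (rule that[of "max D1 (pi * D2)"])
    fix x :: real assume x: "x \<noteq> 0"
    have "cmod (sobolev_kernel a (of_real x)) \<le> D1 / \<bar>x\<bar>" unfolding kernel_of_real norm_of_real by (rule D1[OF x])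
    also have "\<dots> \<le> max D1 (pi * D2) / \<bar>x\<bar>" by (intro divide_right_mono) auto
    finally show "cmod (sobolev_kernel a (of_real x)) \<le> max D1 (pi * D2) / \<bar>x\<bar>" .
    have "cmod (sobolev_kernel' a (of_real x)) \<le> pi * (D2 / \<bar>x\<bar>)"
      unfolding sobolev_kernel'_of_real norm_of_real abs_mult using D2[OF x] by (intro mult_mono) auto
    also have "\<dots> \<le> max D1 (pi * D2) / \<bar>x\<bar>" by (simp add: divide_right_mono)
    finally show "cmod (sobolev_kernel' a (of_real x)) \<le> max D1 (pi * D2) / \<bar>x\<bar>" .
  qed
qed

lemma kernel_square_integrable:
  "integrable lborel (\<lambda>x. (cmod (sobolev_kernel a (of_real x)))\<^sup>2)"
  "integrable lborel (\<lambda>x. (cmod (sobolev_kernel' a (of_real x)))\<^sup>2)"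
proof -
  obtain D where D: "\<And>x. x \<noteq> 0 \<Longrightarrow> cmod (sobolev_kernel a (of_real x)) \<le> D / \<bar>x\<bar>"
    "\<And>x. x \<noteq> 0 \<Longrightarrow> cmod (sobolev_kernel' a (of_real x)) \<le> D / \<bar>x\<bar>"
    using kernel_decay by blast
  have c: "continuous_on UNIV (\<lambda>x. cmod (f (of_real x :: complex)))" if "f holomorphic_on UNIV" for f :: "complex \<Rightarrow> complex"
    by (intro continuous_on_norm continuous_on_compose2[OF holomorphic_on_imp_continuous_on[OF that]] continuous_intros) auto
  show "integrable lborel (\<lambda>x. (cmod (sobolev_kernel a (of_real x)))\<^sup>2)"
    by (rule square_integrable_of_decay[OF c[OF kernel_holomorphic(1)]]) (use D in auto)
  show "integrable lborel (\<lambda>x. (cmod (sobolev_kernel' a (of_real x)))\<^sup>2)"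
    by (rule square_integrable_of_decay[OF c[OF kernel_holomorphic(2)]]) (use D in auto)
qed

text \<open>Besides making the extremal function admissible, this allows the kernel to be paired
  with itself, which yields its Sobolev norm.\<close>

lemma kernel_in_PW2: "sobolev_kernel a \<in> PW2"
proof -
  have "cmod (sobolev_kernel a z) \<le> exp (pi * cmod z)" for z
  proof -
    have "cmod (sobolev_kernel a z) \<le> exp (pi * cmod z) * (1 - 0)"
      unfolding sobolev_kernel_def cos_transform_def
    proof (rule integral_bound)
      show "continuous_on {0..1} (\<lambda>t. of_real (kernel_density a t) * cos (of_real pi * z * of_real t))"
        by (intro continuous_intros continuous_kernel_density)
      fix t :: real assume t: "t \<in> {0..1}"
      have "\<bar>kernel_density a t\<bar> \<le> 1"
        using a density_denominator[of t] by (simp add: kernel_density_def abs_divide)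
      moreover have "cmod (cos (of_real pi * z * of_real t)) \<le> exp (pi * cmod z)"
      proof (rule order_trans[OF norm_cos_le])
        have "(pi * cmod z) * t \<le> (pi * cmod z) * 1" using t by (intro mult_left_mono) auto
        then show "exp (cmod (of_real pi * z * of_real t)) \<le> exp (pi * cmod z)"
          using t by (simp add: norm_mult)
      qed
      ultimately have "\<bar>kernel_density a t\<bar> * cmod (cos (of_real pi * z * of_real t)) \<le> 1 * exp (pi * cmod z)"
        by (intro mult_mono) auto
      then show "norm (of_real (kernel_density a t) * cos (of_real pi * z * of_real t)) \<le> exp (pi * cmod z)"
        by (simp add: norm_mult)
    qed simp
    then show ?thesis by simp
  qed
  then have "cmod (sobolev_kernel a z) \<le> 1 * exp ((pi + \<epsilon>) * cmod z)" if "\<epsilon> > 0" for z \<epsilon>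
    by (rule order_trans) (use that in \<open>auto intro!: mult_right_mono\<close>)
  then have "exponential_type_le pi (sobolev_kernel a)"
    unfolding exponential_type_le_def by (meson zero_less_one)
  then show ?thesis using kernel_holomorphic(1) kernel_square_integrable(1) by (simp add: PW2_def)
qed

lemma kernel_at_0: "sobolev_kernel a 0 = of_real (arctan (pi * sqrt a) / (pi * sqrt a))"
proof -
  let ?s = "pi * sqrt a"
  have s: "?s > 0" using a by simp
  have s2: "?s\<^sup>2 = a * pi\<^sup>2" using a by (simp add: power_mult_distrib)
  have "(kernel_density a has_integral (arctan (?s * 1) / ?s - arctan (?s * 0) / ?s)) {0..1}"
  proof (rule fundamental_theorem_of_calculus)
    fix t :: real assume "t \<in> {0..1}"
    have "((\<lambda>t. arctan (?s * t) / ?s) has_real_derivative (inverse (1 + (?s * t)\<^sup>2) * ?s) / ?s) (at t)"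
      by (auto intro!: derivative_eq_intros)
    moreover have "(inverse (1 + (?s * t)\<^sup>2) * ?s) / ?s = kernel_density a t"
      using s a by (simp add: kernel_density_def inverse_eq_divide power_mult_distrib[of ?s t] s2)
    ultimately have "((\<lambda>t. arctan (?s * t) / ?s) has_real_derivative kernel_density a t) (at t)" by simp
    then show "((\<lambda>t. arctan (?s * t) / ?s) has_vector_derivative kernel_density a t) (at t within {0..1})"
      by (simp add: has_real_derivative_iff_has_vector_derivative has_vector_derivative_at_within)
  qed simp
  then show ?thesis using kernel_of_real[of 0] by (simp add: integral_unique)
qed

text \<open>The pairing is bilinear, without conjugation; as the kernel and its derivative are real
  on the real line, it is nevertheless the Sobolev inner product of \<open>g\<close> with the
  kernel.\<close>

lemma PW2_kernel_pairing:
  assumes g: "g \<in> PW2"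
  shows "integrable lborel (\<lambda>x. g (of_real x) * sobolev_kernel a (of_real x))"
    and "integrable lborel (\<lambda>x. deriv g (of_real x) * sobolev_kernel' a (of_real x))"
    and "(LINT x|lborel. g (of_real x) * sobolev_kernel a (of_real x)) +
         of_real a * (LINT x|lborel. deriv g (of_real x) * sobolev_kernel' a (of_real x)) = g 0"
proof -
  have hol': "deriv g holomorphic_on UNIV" by (rule holomorphic_deriv[OF PW2_D(1)[OF g] open_UNIV])
  note [measurable] = PW2_D(6)[OF g] entire_borel_measurable_of_real[OF hol']
    entire_borel_measurable_of_real[OF kernel_holomorphic(1)] entire_borel_measurable_of_real[OF kernel_holomorphic(2)]
  define f where "f = (\<lambda>x::real. deriv g (of_real x) * sobolev_kernel' a (of_real x) + g (of_real x) * sobolev_kernel'' a (of_real x))"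
  define S where "S = (\<lambda>x::real. g (of_real x) * of_real (sin (pi * x) / x))"
  show I0: "integrable lborel (\<lambda>x. g (of_real x) * sobolev_kernel a (of_real x))"
    by (intro integrable_product PW2_D(3)[OF g] kernel_square_integrable) measurable
  show I1: "integrable lborel (\<lambda>x. deriv g (of_real x) * sobolev_kernel' a (of_real x))"
    by (intro integrable_product PW2_deriv_square_integrable[OF g] kernel_square_integrable) measurable
  have IS: "integrable lborel S" "(LINT x|lborel. S x) = of_real pi * g 0"
    unfolding S_def by (rule PW2_reproducing[OF g])+
  have meas'': "(\<lambda>x. sobolev_kernel'' a (of_real x)) \<in> borel_measurable borel"
    by (intro borel_measurable_continuous_onI continuous_on_compose2[OF sobolev_kernel''_continuous] continuous_intros) auto
  note [measurable] = meas''
  \<comment> \<open>Integrability of g k'' is not estimated directly: the differential equation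
    expresses it, away from 0, through g k and the integrand \<open>S\<close> of the reproducing
    formula. The factor 1 / pi appears because \<open>S\<close> has \<open>x\<close>, not
    \<open>pi * x\<close>, in its denominator.\<close>
  have ae: "AE x in lborel. g (of_real x) * sobolev_kernel'' a (of_real x) = (g (of_real x) * sobolev_kernel a (of_real x) - S x / of_real pi) / of_real a"
  proof (rule eventually_mono[OF AE_lborel_singleton[of 0]])
    fix x :: real assume x: "x \<noteq> 0"
    have "sobolev_kernel'' a (of_real x) = (sobolev_kernel a (of_real x) - of_real (sin (pi * x) / (pi * x))) / of_real a"
      using kernel_ode[OF x] a by (simp add: field_simps)
    then show "g (of_real x) * sobolev_kernel'' a (of_real x) = (g (of_real x) * sobolev_kernel a (of_real x) - S x / of_real pi) / of_real a"
      by (simp add: S_def algebra_simps)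
  qed
  have [measurable]: "S \<in> borel_measurable borel" using borel_measurable_integrable[OF IS(1)] by simp
  have IR: "integrable lborel (\<lambda>x. (g (of_real x) * sobolev_kernel a (of_real x) - S x / of_real pi) / of_real a)"
    by (intro integrable_divide Bochner_Integration.integrable_diff I0 IS)
  have I2: "integrable lborel (\<lambda>x. g (of_real x) * sobolev_kernel'' a (of_real x))"
    by (subst integrable_cong_AE[OF _ _ ae]) (use IR in measurable)
  have L2: "(LINT x|lborel. g (of_real x) * sobolev_kernel'' a (of_real x)) = ((LINT x|lborel. g (of_real x) * sobolev_kernel a (of_real x)) - g 0) / of_real a"
    by (subst integral_cong_AE[OF _ _ ae], measurable)
       (simp add: Bochner_Integration.integral_diff[OF I0 integrable_divide[OF IS(1)]] IS(2))
  \<comment> \<open>Integration by parts on the whole line: \<open>f\<close> is the derivative of g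
    k', which vanishes at both ends because \<open>g\<close> is bounded there and k' decays like 1 /
    |x|.\<close>
  have "(LBINT x=-\<infinity>..\<infinity>. f x) = 0 - 0"
  proof (rule interval_integral_FTC_integrable[where F="\<lambda>x. g (of_real x) * sobolev_kernel' a (of_real x)"])
    show "((\<lambda>x. g (of_real x) * sobolev_kernel' a (of_real x)) has_vector_derivative f x) (at x)" for x
      unfolding f_def
      by (rule has_vector_derivative_real_field)
         (use DERIV_mult[OF PW2_D(5)[OF g, of "of_real x"] DERIV_kernel'[of "of_real x"]] in \<open>simp add: mult.commute add.commute\<close>)
    have "continuous_on UNIV f" unfolding f_def
      by (intro continuous_intros continuous_on_compose2[OF sobolev_kernel''_continuous]
          continuous_on_compose2[OF holomorphic_on_imp_continuous_on[OF hol']]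
          continuous_on_compose2[OF holomorphic_on_imp_continuous_on[OF kernel_holomorphic(2)]]
          continuous_on_compose2[OF PW2_D(4)[OF g, of UNIV]]) auto
    then show "isCont f x" for x by (simp add: continuous_on_eq_continuous_at)
    show "set_integrable lborel (einterval (-\<infinity>) \<infinity>) f"
      unfolding f_def set_integrable_def using I1 I2 by simp
    obtain B where B: "\<And>x::real. cmod (g (of_real x)) \<le> B"
      using PW2_bounded_on_reals[OF g] by blast
    have B0: "B \<ge> 0" by (rule order_trans[OF norm_ge_zero B[of 0]])
    obtain D where D: "\<And>x. x \<noteq> 0 \<Longrightarrow> cmod (sobolev_kernel' a (of_real x)) \<le> D / \<bar>x\<bar>"
      using kernel_decay by blast
    have bd: "norm (g (of_real x) * sobolev_kernel' a (of_real x)) \<le> B * (D / \<bar>x\<bar>)" if "x \<noteq> 0" for x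
      unfolding norm_mult by (intro mult_mono B D that B0) auto
    have "((\<lambda>x. g (of_real x) * sobolev_kernel' a (of_real x)) \<longlongrightarrow> 0) at_top"
    proof (rule Lim_null_comparison)
      show "\<forall>\<^sub>F x in at_top. norm (g (of_real x) * sobolev_kernel' a (of_real x)) \<le> B * (D / \<bar>x\<bar>)"
        by (rule eventually_mono[OF eventually_gt_at_top[of 0]]) (rule bd, simp)
      show "((\<lambda>x. B * (D / \<bar>x\<bar>)) \<longlongrightarrow> 0) at_top" by real_asymp
    qed
    then show "(((\<lambda>x. g (of_real x) * sobolev_kernel' a (of_real x)) \<circ> real_of_ereal) \<longlongrightarrow> 0) (at_left \<infinity>)"
      by (simp add: ereal_tendsto_simps1)
    have "((\<lambda>x. g (of_real x) * sobolev_kernel' a (of_real x)) \<longlongrightarrow> 0) at_bot"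
    proof (rule Lim_null_comparison)
      show "\<forall>\<^sub>F x in at_bot. norm (g (of_real x) * sobolev_kernel' a (of_real x)) \<le> B * (D / \<bar>x\<bar>)"
        by (rule eventually_mono[OF eventually_gt_at_bot[of 0]]) (rule bd, simp)
      show "((\<lambda>x. B * (D / \<bar>x\<bar>)) \<longlongrightarrow> 0) at_bot" by real_asymp
    qed
    then show "(((\<lambda>x. g (of_real x) * sobolev_kernel' a (of_real x)) \<circ> real_of_ereal) \<longlongrightarrow> 0) (at_right (-\<infinity>))"
      by (simp add: ereal_tendsto_simps1)
  qed auto
  then have "(LINT x|lborel. f x) = 0"
    by (simp add: interval_lebesgue_integral_def set_lebesgue_integral_def)
  then have "(LINT x|lborel. deriv g (of_real x) * sobolev_kernel' a (of_real x)) = - (LINT x|lborel. g (of_real x) * sobolev_kernel'' a (of_real x))"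
    unfolding f_def Bochner_Integration.integral_add[OF I1 I2] by (simp add: add_eq_0_iff2)
  then show "(LINT x|lborel. g (of_real x) * sobolev_kernel a (of_real x)) +
         of_real a * (LINT x|lborel. deriv g (of_real x) * sobolev_kernel' a (of_real x)) = g 0"
    unfolding L2 using a by simp
qed

text \<open>Completing the square in the Sobolev norm: the energy of g - c k is E(g) - 2 c Re(g,k) +
  c^2 (k,k). The pairing gives (g,k) = g(0) = 1 and (k,k) = k(0) = 1/c, so the last two terms add up
  to -c.\<close>

lemma sobolev_energy_expansion:
  assumes g: "g \<in> PW2" "g 0 = 1"
  defines "c \<equiv> pi * sqrt a / arctan (pi * sqrt a)"
  defines "\<phi> \<equiv> \<lambda>x::real. (cmod (g (of_real x) - of_real c * sobolev_kernel a (of_real x)))\<^sup>2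
    + a * (cmod (deriv g (of_real x) - of_real c * sobolev_kernel' a (of_real x)))\<^sup>2"
  shows "integrable lborel \<phi>" and "sobolev_energy a g = c + (LINT x|lborel. \<phi> x)"
proof -
  have dK: "deriv (sobolev_kernel a) z = sobolev_kernel' a z" for z by (rule DERIV_imp_deriv[OF DERIV_kernel])
  note P = PW2_kernel_pairing[OF g(1)]
  note M = kernel_square_integrable
  note N0 = PW2_D(3)[OF g(1)] and N1 = PW2_deriv_square_integrable[OF g(1)]
  have expand: "(cmod (u - of_real c * of_real k))\<^sup>2 = (cmod u)\<^sup>2 - 2 * c * Re (u * of_real k) + c\<^sup>2 * (cmod (of_real k))\<^sup>2" for u k
    unfolding cmod_power2 by (simp add: power2_eq_square algebra_simps)
  have \<phi>: "\<phi> = (\<lambda>x. ((cmod (g (of_real x)))\<^sup>2 - 2 * c * Re (g (of_real x) * sobolev_kernel a (of_real x)) + c\<^sup>2 * (cmod (sobolev_kernel a (of_real x)))\<^sup>2)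
    + a * ((cmod (deriv g (of_real x)))\<^sup>2 - 2 * c * Re (deriv g (of_real x) * sobolev_kernel' a (of_real x)) + c\<^sup>2 * (cmod (sobolev_kernel' a (of_real x)))\<^sup>2))"
    unfolding \<phi>_def kernel_of_real sobolev_kernel'_of_real expand ..
  show "integrable lborel \<phi>" unfolding \<phi>
    by (intro Bochner_Integration.integrable_add Bochner_Integration.integrable_diff integrable_mult_right integrable_Re P M N0 N1)
  define m0 where "m0 = (LINT x|lborel. (cmod (sobolev_kernel a (of_real x)))\<^sup>2)"
  define m1 where "m1 = (LINT x|lborel. (cmod (sobolev_kernel' a (of_real x)))\<^sup>2)"
  define n0 where "n0 = (LINT x|lborel. (cmod (g (of_real x)))\<^sup>2)"
  define n1 where "n1 = (LINT x|lborel. (cmod (deriv g (of_real x)))\<^sup>2)"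
  define p0 where "p0 = (LINT x|lborel. g (of_real x) * sobolev_kernel a (of_real x))"
  define p1 where "p1 = (LINT x|lborel. deriv g (of_real x) * sobolev_kernel' a (of_real x))"
  have "p0 + of_real a * p1 = 1" using P(3) g(2) by (simp add: p0_def p1_def)
  from arg_cong[OF this, of Re] have p: "Re p0 + a * Re p1 = 1" by simp
  have "sobolev_kernel a (of_real x) * sobolev_kernel a (of_real x) = of_real ((cmod (sobolev_kernel a (of_real x)))\<^sup>2)"
    "sobolev_kernel' a (of_real x) * sobolev_kernel' a (of_real x) = of_real ((cmod (sobolev_kernel' a (of_real x)))\<^sup>2)" for x
    unfolding kernel_of_real sobolev_kernel'_of_real norm_of_real power2_abs by (simp_all add: power2_eq_square)
  \<comment> \<open>The pairing for \<open>g\<close> equal to the kernel itself: its squared Sobolev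
    norm is its value at 0. Realness on the real line turns the products into squared
    moduli.\<close>
  with PW2_kernel_pairing(3)[OF kernel_in_PW2] have "of_real (m0 + a * m1) = sobolev_kernel a 0"
    by (simp add: dK m0_def m1_def del: of_real_power)
  then have m: "m0 + a * m1 = 1 / c" unfolding kernel_at_0 of_real_eq_iff by (simp add: c_def)
  have "arctan (pi * sqrt a) > 0" using a by simp
  then have c: "c > 0" unfolding c_def using a by simp
  have "(LINT x|lborel. \<phi> x) = (n0 - 2 * c * Re p0 + c\<^sup>2 * m0) + a * (n1 - 2 * c * Re p1 + c\<^sup>2 * m1)"
  proof -
    define G0 where "G0 x = g (of_real x) * sobolev_kernel a (of_real x)" for x
    define G1 where "G1 x = deriv g (of_real x) * sobolev_kernel' a (of_real x)" for x
    have "integrable lborel G0" "integrable lborel G1"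
      using P(1,2) by (simp_all add: G0_def[abs_def] G1_def[abs_def])
    then show ?thesis
      unfolding \<phi> n0_def n1_def m0_def m1_def p0_def p1_def G0_def[symmetric] G1_def[symmetric]
      using M N0 N1 by simp
  qed
  also have "\<dots> = (n0 + a * n1) - 2 * c * (Re p0 + a * Re p1) + c * (c * (m0 + a * m1))"
    by (simp add: algebra_simps power2_eq_square)
  also have "\<dots> = (n0 + a * n1) - c" unfolding p m using c by simp
  also have "n0 + a * n1 = sobolev_energy a g"
    unfolding sobolev_energy_def n0_def n1_def using N0 N1 by simp
  finally show "sobolev_energy a g = c + (LINT x|lborel. \<phi> x)" by simp
qed

end

section \<open>Vanishing of the remainder and the conclusion\<close>

lemma PW2_cmult:
  assumes g: "g \<in> PW2"
  shows "(\<lambda>z. c * g z) \<in> PW2"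
proof -
  have "\<exists>C>0. \<forall>z. cmod (c * g z) \<le> C * exp ((pi + \<epsilon>) * cmod z)" if \<epsilon>: "\<epsilon> > 0" for \<epsilon>
  proof -
    obtain C where C: "C > 0" "\<And>z. cmod (g z) \<le> C * exp ((pi + \<epsilon>) * cmod z)"
      using PW2_D(2)[OF g] \<epsilon> unfolding exponential_type_le_def by blast
    have "cmod (c * g z) \<le> ((cmod c + 1) * C) * exp ((pi + \<epsilon>) * cmod z)" for z
      unfolding norm_mult mult.assoc by (intro mult_mono C) auto
    moreover have "(cmod c + 1) * C > 0" using C(1) by (simp add: add_nonneg_pos)
    ultimately show ?thesis by blast
  qed
  then show ?thesis using PW2_D(1,3)[OF g]
    by (auto simp: PW2_def exponential_type_le_def norm_mult power_mult_distrib intro!: holomorphic_intros)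
qed

text \<open>A nonnegative integrand with integral 0 vanishes almost everywhere; continuity extends
  this to the whole real line, since a nonempty open set is not null, and the identity theorem to
  the plane. The hypothesis \<open>int\<close> excludes an integral that is 0 only by
  default.\<close>

lemma entire_zero_of_integral_zero:
  fixes h \<psi> :: "complex \<Rightarrow> complex"
  assumes hol: "h holomorphic_on UNIV" and "a \<ge> 0"
    and int: "integrable lborel (\<lambda>x. (cmod (h (of_real x)))\<^sup>2 + a * (cmod (\<psi> (of_real x)))\<^sup>2)"
    and zero: "(LINT x|lborel. (cmod (h (of_real x)))\<^sup>2 + a * (cmod (\<psi> (of_real x)))\<^sup>2) = 0"
  shows "h w = 0"
proof -
  have cont: "continuous_on UNIV (\<lambda>x::real. h (of_real x))"
    by (intro continuous_on_compose2[OF holomorphic_on_imp_continuous_on[OF hol]] continuous_intros) auto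
  have "AE x in lborel. (cmod (h (of_real x)))\<^sup>2 + a * (cmod (\<psi> (of_real x)))\<^sup>2 = 0"
    using integral_nonneg_eq_0_iff_AE[OF int] zero \<open>a \<ge> 0\<close> by simp
  then have ae: "AE x in lborel. h (of_real x) = 0"
  proof eventually_elim
    case (elim x)
    moreover have "0 \<le> a * (cmod (\<psi> (of_real x)))\<^sup>2" using \<open>a \<ge> 0\<close> by simp
    ultimately have "(cmod (h (of_real x)))\<^sup>2 = 0" by (smt (verit) zero_le_power2)
    then show ?case by simp
  qed
  have real0: "h (of_real x) = 0" for x
  proof (rule ccontr)
    assume nz: "h (of_real x) \<noteq> 0"
    define U where "U = {x::real. h (of_real x) \<noteq> 0}"
    have "U = (\<lambda>x. h (of_real x)) -` (- {0})" by (auto simp: U_def)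
    then have "open U" using open_vimage[OF _ cont, of "- {0}"] by (simp add: open_Compl)
    moreover have "x \<in> U" using nz by (simp add: U_def)
    ultimately have "\<not> negligible U" using open_not_negligible by blast
    moreover have "U \<in> null_sets lborel"
      using ae \<open>open U\<close> by (subst AE_iff_null_sets) (auto simp: U_def)
    ultimately show False
      using negligible_iff_null_sets null_sets_completionI by blast
  qed
  show ?thesis
  proof (rule analytic_continuation[OF hol open_UNIV connected_UNIV, of "range of_real" 0])
    show "(0::complex) islimpt range of_real"
      unfolding islimpt_approachable
    proof (intro allI impI)
      fix e :: real assume "e > 0"
      then show "\<exists>x'\<in>range of_real. x' \<noteq> (0::complex) \<and> dist x' 0 < e"
        by (intro bexI[of _ "of_real (e / 2)"]) (auto simp: dist_norm simp del: of_real_divide)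
    qed
  qed (auto simp: real0)
qed

theorem corollary3:
  fixes a :: real
  assumes "a > 0"
  shows "(\<forall>g\<in>PW2. g 0 = 1 \<longrightarrow>
            pi * sqrt a / arctan (pi * sqrt a) \<le> sobolev_energy a g) \<and>
         (\<forall>g. (g \<in> PW2 \<and> g 0 = 1 \<and>
               pi * sqrt a / arctan (pi * sqrt a) = sobolev_energy a g) \<longleftrightarrow>
            g = (\<lambda>z. complex_of_real (pi * sqrt a / arctan (pi * sqrt a)) *
                  integral {0..1} (\<lambda>t::real. cos (complex_of_real pi * z * complex_of_real t) /
                    complex_of_real (1 + a * pi\<^sup>2 * t\<^sup>2))))"
proof -
  define c where "c = pi * sqrt a / arctan (pi * sqrt a)"
  define k where "k = (\<lambda>z. of_real c * sobolev_kernel a z)"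
  have "arctan (pi * sqrt a) > 0" using assms by simp
  then have c: "c > 0" unfolding c_def using assms by simp
  have kernel_eq: "(\<lambda>z. complex_of_real (pi * sqrt a / arctan (pi * sqrt a)) *
                  integral {0..1} (\<lambda>t::real. cos (complex_of_real pi * z * complex_of_real t) /
                    complex_of_real (1 + a * pi\<^sup>2 * t\<^sup>2))) = k"
    by (simp add: k_def c_def sobolev_kernel_def cos_transform_def kernel_density_def)
  have k: "k \<in> PW2" unfolding k_def by (rule PW2_cmult[OF kernel_in_PW2[OF assms]])
  have k0: "k 0 = 1" using c assms unfolding k_def kernel_at_0[OF assms] by (simp add: c_def)
  have dk: "deriv k z = of_real c * sobolev_kernel' a z" for z
    unfolding k_def by (intro DERIV_imp_deriv DERIV_cmult DERIV_kernel[OF assms])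
  \<comment> \<open>For g = k the remainder in the expansion is the integral of the zero
    function.\<close>
  have attained: "c = sobolev_energy a k"
    using sobolev_energy_expansion(2)[OF assms k k0] by (simp add: c_def[symmetric] dk) (simp add: k_def)
  have lower: "c \<le> sobolev_energy a g" if "g \<in> PW2" "g 0 = 1" for g
  proof -
    have "sobolev_energy a g - c \<ge> 0"
      unfolding sobolev_energy_expansion(2)[OF assms that] c_def
      using assms by (simp add: Bochner_Integration.integral_nonneg)
    then show ?thesis by simp
  qed
  have unique: "g = k" if g: "g \<in> PW2" "g 0 = 1" and eq: "c = sobolev_energy a g" for g
  proof
    fix w
    note E = sobolev_energy_expansion[OF assms g, folded c_def]
    have hol: "(\<lambda>z. g z - k z) holomorphic_on UNIV"
      by (intro holomorphic_intros PW2_D(1) g k)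
    have "(\<lambda>z. g z - k z) w = 0"
      \<comment> \<open>Equality of the energy with \<open>c\<close> says that the remainder
        integral is 0; its first summand is the squared modulus of \<open>g - k\<close> on the real
        line.\<close>
      by (rule entire_zero_of_integral_zero[OF hol, where a=a and \<psi>="\<lambda>z. deriv g z - of_real c * sobolev_kernel' a z"])
         (use assms E(1) E(2)[unfolded eq[symmetric]] in \<open>simp_all add: k_def\<close>)
    then show "g w = k w" by simp
  qed
  show ?thesis unfolding kernel_eq unfolding c_def[symmetric]
  proof (intro conjI allI ballI impI)
    fix g
    show "(g \<in> PW2 \<and> g 0 = 1 \<and> c = sobolev_energy a g) \<longleftrightarrow> g = k"
    proof
      assume "g \<in> PW2 \<and> g 0 = 1 \<and> c = sobolev_energy a g"
      then show "g = k" using unique by simp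
    next
      assume "g = k"
      then show "g \<in> PW2 \<and> g 0 = 1 \<and> c = sobolev_energy a g" using k k0 attained by simp
    qed
  qed (rule lower)
qed

end
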